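(* Fix $\delta\in(0,0.1]$. Let $d,k,n\in\mathbb{N}$ with $d\ge k$ (where $d=d(n)$, $k=k(n)$, asymptotics as $n\to\infty$) and $\theta\in(0,1)$ (possibly depending on $n$), and suppose that $n=o(\min(d,k^{2-\delta}))$. Let $\mathcal P_n$ be the joint distribution of $n$ samples from the planted distribution $\mathcal P$, and $\mathcal Q_n$ the joint distribution of $n$ samples from the null distribution $\mathcal Q$, in the problem $\mathrm{NegSPCA}_\theta$. Then for any (not identically zero) polynomial $f(z_1,\dots,z_n):\mathbb{R}^{n\times(d+1)}\to\mathbb{R}$ of degree at most $k^\delta$ such that $\mathbb{E}_{\mathcal Q_n}f=0$, we have $$\frac{\mathbb{E}_{\mathcal P_n}f}{\sqrt{\mathbb{E}_{\mathcal Q_n}f^2}}\le 1+o(1).$$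
   Context: **The problem $\mathrm{NegSPCA}_\theta$** (parameters $d\ge k$, $n$, $\theta\in(0,1)$). - Planted $\mathcal P$: sample once a unit vector $x\in\mathbb{R}^{d+1}$ with first coordinate $x_1=-\frac1{\sqrt{k+1}}$ and remaining coordinates $x_{\setminus 1}$ uniform over the vectors in $\{\pm\frac1{\sqrt{k+1}},0\}^d$ with exactly $k$ non-zero entries; with this same $x$ fixed, all $n$ samples $z_1,\dots,z_n$ are drawn i.i.d. from $N(0,\mathrm{Id}_{d+1}-\theta xx^\top)$. (So $\mathcal P_n$ is the mixture over $x$ of the $n$-fold products.) - Null $\mathcal Q$: $z_1,\dots,z_n$ are i.i.d. from $N(0,\mathrm{Id}_{d+1})$. The $o(1)$ term is uniform over the polynomials $f$. *)

theory Defs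
  imports
    "HOL-Probability.Probability"
    "HOL-Library.Poly_Mapping"
    "HOL-Library.Landau_Symbols"
    "Jordan_Normal_Form.Determinant"
    "Jordan_Normal_Form.Gauss_Jordan_Elimination"
begin

hide_const (open) Finite_Cartesian_Product.vec Finite_Cartesian_Product.mat
  Determinants.det
unbundle no vec_syntax

text \<open>
  The centred Gaussian law \<open>N(0, \<Sigma>)\<close> on \<open>\<real>\<^sup>m\<close>, given by its Lebesgue density
  \<open>exp (- z\<^sup>T \<Sigma>\<^sup>-\<^sup>1 z / 2) / sqrt ((2 \<pi>)\<^sup>m det \<Sigma>)\<close>; a point of \<open>\<real>\<^sup>m\<close> is a function on the index
  set \<open>{..<m}\<close> (extensional, as for every \<open>Pi\<^sub>M\<close>).  Only meaningful for symmetric positive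
  definite \<open>\<Sigma>\<close>; then \<open>mat_inverse \<Sigma>\<close> is \<open>Some\<close> of the inverse.
\<close>
definition mv_normal :: "nat \<Rightarrow> real mat \<Rightarrow> (nat \<Rightarrow> real) measure" where
  "mv_normal m \<Sigma> = density (Pi\<^sub>M {..<m} (\<lambda>_. lborel))
     (\<lambda>z. ennreal (exp (- (vec m z \<bullet> (the (mat_inverse \<Sigma>) *\<^sub>v vec m z)) / 2)
        / sqrt ((2 * pi) ^ m * det \<Sigma>)))"

text \<open>
  The possible spikes; the distinguished first coordinate of \<open>x \<in> \<real>\<^sup>d\<^sup>+\<^sup>1\<close> has index 0.
\<close>
definition spikes :: "nat \<Rightarrow> nat \<Rightarrow> real vec set" where
  "spikes d k = {x \<in> carrier_vec (d + 1).
     x $ 0 = - 1 / sqrt (real (k + 1)) \<and>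
     (\<forall>i\<in>{1..d}. x $ i \<in> {1 / sqrt (real (k + 1)), - 1 / sqrt (real (k + 1)), 0}) \<and>
     card {i \<in> {1..d}. x $ i \<noteq> 0} = k}"

definition spiked_cov :: "nat \<Rightarrow> real \<Rightarrow> real vec \<Rightarrow> real mat" where
  "spiked_cov d \<theta> x =
     1\<^sub>m (d + 1) - \<theta> \<cdot>\<^sub>m mat (d + 1) (d + 1) (\<lambda>(i, j). x $ i * x $ j)"

text \<open>
  A tuple of \<open>n\<close> samples is a function \<open>z\<close> with \<open>z i j\<close> the coordinate \<open>j \<in> {..d}\<close> of sample
  \<open>i \<in> {..<n}\<close>.  The spike is drawn once and shared by all samples, so the planted law is a
  mixture of product measures.  The mixing measure lives on the finite space \<open>spikes d k\<close>, on
  which all covariances are positive definite, so the kernel is a genuine probability kernel.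
\<close>
definition planted_law :: "nat \<Rightarrow> nat \<Rightarrow> real \<Rightarrow> nat \<Rightarrow> (nat \<Rightarrow> nat \<Rightarrow> real) measure" where
  "planted_law d k \<theta> n = Giry_Monad.bind (uniform_count_measure (spikes d k))
     (\<lambda>x. Pi\<^sub>M {..<n} (\<lambda>_. mv_normal (d + 1) (spiked_cov d \<theta> x)))"

definition null_law :: "nat \<Rightarrow> nat \<Rightarrow> (nat \<Rightarrow> nat \<Rightarrow> real) measure" where
  "null_law d n = Pi\<^sub>M {..<n} (\<lambda>_. mv_normal (d + 1) (1\<^sub>m (d + 1)))"

text \<open>
  Real polynomials in indeterminates indexed by \<open>'v\<close>: finitely supported maps from monomials
  (finitely supported exponent vectors) to coefficients.
\<close>
type_synonym 'v rpoly = "('v \<Rightarrow>\<^sub>0 nat) \<Rightarrow>\<^sub>0 real"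

definition rpoly_vars :: "'v rpoly \<Rightarrow> 'v set" where
  "rpoly_vars p = (\<Union>m\<in>Poly_Mapping.keys p. Poly_Mapping.keys m)"

text \<open>Inserting 0 gives the zero polynomial degree 0.\<close>
definition rpoly_degree :: "'v rpoly \<Rightarrow> nat" where
  "rpoly_degree p = Max (insert 0
     ((\<lambda>m. \<Sum>v\<in>Poly_Mapping.keys m. Poly_Mapping.lookup m v) ` Poly_Mapping.keys p))"

definition rpoly_eval :: "'v rpoly \<Rightarrow> ('v \<Rightarrow> real) \<Rightarrow> real" where
  "rpoly_eval p a = (\<Sum>m\<in>Poly_Mapping.keys p. Poly_Mapping.lookup p m *
     (\<Prod>v\<in>Poly_Mapping.keys m. a v ^ Poly_Mapping.lookup m v))"

text \<open>The indeterminate \<open>(i, j)\<close> stands for coordinate \<open>j\<close> of sample \<open>i\<close>.\<close>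
abbreviation sample_eval :: "(nat \<times> nat) rpoly \<Rightarrow> (nat \<Rightarrow> nat \<Rightarrow> real) \<Rightarrow> real" where
  "sample_eval p z \<equiv> rpoly_eval p (\<lambda>(i, j). z i j)"

end

theory Submission
  imports Defs "HOL-Real_Asymp.Real_Asymp"
begin

text \<open>
  Expand \<open>f\<close> in products of Hermite polynomials, an orthogonal system under the null law.  A spiked
  sample has Hermite coefficient \<open>w (|a|) x\<^sup>a\<close> with \<open>w\<close> supported on even degrees and \<open>w (l)\<^sup>2 \<le> l!\<close>,
  so Cauchy--Schwarz bounds the squared advantage by
  \<open>\<Sum>\<^bsub>1 \<le> M \<le> deg f\<^esub> K (n, M) E \<langle>x, x'\<rangle>\<^sup>M\<close> for independent spikes \<open>x, x'\<close>.  Both factors are coefficients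
  of generating functions and are bounded by evaluating these at a suitable point.  The level-\<open>M\<close>
  term is then at most \<open>(e\<^sup>6 (n + M) (k\<^sup>2 / d + M) / k\<^sup>2)\<close> to the power \<open>M / 2\<close>, hence at most \<open>2\<close> to the
  power \<open>- M\<close> once \<open>n\<close> is large, and the whole sum is at most 1.
\<close>

section \<open>Hermite polynomials of a standard normal variable\<close>

text \<open>Squaring a planted coefficient brings in the second spike. A sample's coefficient
  depends on its exponents only through their sum and the monomial in x, so the multinomial theorem
  sums all exponent vectors of degree m in one row to a multiple of <x, x'>^m, and the product over
  the rows sees only <x, x'>^M. Hence each level splits into a factor for the sample size and a
  factor for the prior. The exponent M / 2 comes from two parities: no row has odd degree, so at
  most M / 2 rows are used; and random signs kill odd powers of the random coordinates, so at most M
  / 2 of these are used, each costing a squared support probability (k / d)^2. The first coordinate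
  has a fixed sign and escapes the second parity, but being a single coordinate it costs only a
  factor e. Of the four products in (n + M) (k^2 / d + M), the term n k^2 / d is small because n =
  o(d), n M because n = o(k^(2 - \<delta>)) and M <= k^\<delta>, and the other two because \<delta>
  < 1 and k <= d.\<close>

lemma integrable_poly_std_normal:
  "integrable std_normal_distribution (poly (p :: real poly))"
proof -
  have "integrable lborel (\<lambda>x. \<Sum>i\<le>degree p. coeff p i * (std_normal_density x * x ^ i))"
    by (intro Bochner_Integration.integrable_sum integrable_mult_right integrable_std_normal_moment)
  then show ?thesis
    by (subst integrable_density)
       (auto simp: poly_altdef[abs_def] sum_distrib_left mult_ac)
qed

lemma tendsto_poly_std_normal_density:
  fixes p :: "real poly"
  assumes "F \<in> {at_top, at_bot}"
  shows "((\<lambda>x. poly p x * std_normal_density x) \<longlongrightarrow> 0) F"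
proof -
  have "((\<lambda>x::real. x ^ i * exp (- x\<^sup>2 / 2)) \<longlongrightarrow> 0) at_top" for i by real_asymp
  moreover have "((\<lambda>x::real. x ^ i * exp (- x\<^sup>2 / 2)) \<longlongrightarrow> 0) at_bot" for i by real_asymp
  ultimately have *: "((\<lambda>x::real. x ^ i * exp (- x\<^sup>2 / 2)) \<longlongrightarrow> 0) F" for i using assms by auto
  have "((\<lambda>x. \<Sum>i\<le>degree p. (coeff p i / sqrt (2 * pi)) * (x ^ i * exp (- x\<^sup>2 / 2))) \<longlongrightarrow>
      (\<Sum>i\<le>degree p. (coeff p i / sqrt (2 * pi)) * 0)) F"
    by (intro tendsto_intros *)
  then show ?thesis
    by (simp add: poly_altdef sum_distrib_left sum_divide_distrib normal_density_def mult_ac)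
qed

text \<open>The derivative of p(x) exp(i s x) times the Gaussian density has integral 0. The
  exponential is carried along so that one identity yields both the orthogonality relations (s = 0)
  and the Fourier transforms (general s).\<close>

lemma std_normal_integration_by_parts:
  fixes p :: "real poly" and s :: real
  shows "(LINT x|std_normal_distribution.
      of_real (x * poly p x - poly (pderiv p) x) * iexp (s * x)) =
    \<i> * s * (LINT x|std_normal_distribution. of_real (poly p x) * iexp (s * x))" (is "?L = ?R")
proof -
  define G where "G x = complex_of_real (poly p x * std_normal_density x) * iexp (s * x)" for x
  define q where "q x = (of_real (poly (pderiv p) x - x * poly p x) + \<i> * s * of_real (poly p x))
     * iexp (s * x)" for x :: real
  have norm_q: "integrable std_normal_distribution (\<lambda>x. complex_of_real (poly r x) * iexp (s * x))"
    for r :: "real poly"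
    by (rule Bochner_Integration.integrable_bound[OF integrable_poly_std_normal[of r]])
       (auto simp: norm_mult intro!: borel_measurable_continuous_onI continuous_intros)
  define r where "r = pCons 0 p - pderiv p"
  have r: "x * poly p x - poly (pderiv p) x = poly r x" for x by (simp add: r_def)
  have int: "integrable std_normal_distribution q"
  proof -
    have "q = (\<lambda>x. \<i> * s * (complex_of_real (poly p x) * iexp (s * x)) -
        complex_of_real (poly r x) * iexp (s * x))"
      by (auto simp: q_def r[symmetric] algebra_simps)
    then show ?thesis using norm_q by simp
  qed
  have intl: "integrable lborel (\<lambda>x. std_normal_density x *\<^sub>R q x)"
    using int by (subst (asm) integrable_density)
      (auto simp: q_def intro!: borel_measurable_continuous_onI continuous_intros)
  have dphi: "(std_normal_density has_real_derivative - x * std_normal_density x) (at x)" for x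
    unfolding normal_density_def
    by (auto intro!: derivative_eq_intros simp: field_simps)
  have dG: "(G has_vector_derivative std_normal_density x *\<^sub>R q x) (at x)" for x
  proof -
    have 1: "((\<lambda>x. complex_of_real (poly p x * std_normal_density x)) has_vector_derivative
       of_real (poly (pderiv p) x * std_normal_density x - poly p x * x * std_normal_density x)) (at x)"
      by (intro has_vector_derivative_of_real)
         (auto intro!: derivative_eq_intros dphi simp flip: has_real_derivative_iff_has_vector_derivative)
    have "((\<lambda>z. exp (\<i> * of_real s * z)) has_field_derivative \<i> * s * iexp (s * x)) (at (of_real x))"
      by (auto intro!: derivative_eq_intros simp: mult_ac)
    from has_vector_derivative_real_field[OF this]
    have 2: "((\<lambda>x. iexp (s * x)) has_vector_derivative \<i> * s * iexp (s * x)) (at x)"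
      by (simp add: mult.assoc)
    show ?thesis unfolding G_def
      by (rule has_vector_derivative_eq_rhs[OF has_vector_derivative_mult[OF 1 2]])
         (simp add: q_def scaleR_conv_of_real algebra_simps)
  qed
  have lim: "(G \<longlongrightarrow> 0) F" if "F \<in> {at_top, at_bot}" for F
    by (rule tendsto_norm_zero_cancel)
       (use tendsto_norm_zero[OF tendsto_poly_std_normal_density[OF that, of p]] in \<open>simp add: G_def norm_mult abs_mult\<close>)
  have "(LBINT x=-\<infinity>..\<infinity>. std_normal_density x *\<^sub>R q x) = 0 - 0"
  proof (rule interval_integral_FTC_integrable[where F = G])
    show "isCont (\<lambda>x. std_normal_density x *\<^sub>R q x) x" for x
      unfolding q_def normal_density_def by (intro continuous_intros) auto
    show "set_integrable lborel (einterval (- \<infinity>) \<infinity>) (\<lambda>x. std_normal_density x *\<^sub>R q x)"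
      using intl by (simp add: set_integrable_def)
    show "((G \<circ> real_of_ereal) \<longlongrightarrow> 0) (at_right (-\<infinity>))"
      unfolding at_right_MInf filterlim_filtermap comp_def by (simp add: lim)
    show "((G \<circ> real_of_ereal) \<longlongrightarrow> 0) (at_left \<infinity>)"
      unfolding at_left_PInf filterlim_filtermap comp_def by (simp add: lim)
  qed (use dG in auto)
  then have "(LINT x|lborel. std_normal_density x *\<^sub>R q x) = 0"
    by (simp add: interval_lebesgue_integral_def set_lebesgue_integral_def)
  then have "(LINT x|std_normal_distribution. q x) = 0"
    by (subst integral_density)
      (auto simp: q_def intro!: borel_measurable_continuous_onI continuous_intros)
  also have "q = (\<lambda>x. \<i> * s * (complex_of_real (poly p x) * iexp (s * x)) -
        complex_of_real (poly r x) * iexp (s * x))"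
    by (auto simp: q_def r[symmetric] algebra_simps)
  finally show ?thesis using norm_q by (simp add: r)
qed

text \<open>The probabilists' polynomials, generated by x - d/dx, the adjoint of differentiation in
  L^2 of the Gaussian. In this form the integration by parts above is the induction step of the
  facts below.\<close>

fun hermite :: "nat \<Rightarrow> real poly" where
  "hermite 0 = 1"
| "hermite (Suc n) = pCons 0 (hermite n) - pderiv (hermite n)"

lemma hermite_fourier:
  "(LINT x|std_normal_distribution. of_real (poly (hermite n) x) * iexp (s * x)) =
    (\<i> * s) ^ n * of_real (exp (- s\<^sup>2 / 2))"
proof (induction n)
  case 0
  then show ?case
    using char_std_normal_distribution by (simp add: char_def fun_eq_iff)
next
  case (Suc n)
  then show ?case using std_normal_integration_by_parts[of "hermite n" s] by simp
qed

text \<open>Integration by parts at s = 0, applied to the product \<open>hermite n * q\<close>: one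
  Hermite step on the left factor becomes a derivative of the right one.\<close>

lemma std_normal_hermite_Suc:
  "(LINT x|std_normal_distribution. poly (hermite (Suc n)) x * poly q x) =
    (LINT x|std_normal_distribution. poly (hermite n) x * poly (pderiv q) x)"
proof -
  have *: "(LINT x|std_normal_distribution. x * poly p x - poly (pderiv p) x) = 0" for p
    using std_normal_integration_by_parts[of p 0] by (simp flip: of_real_diff of_real_mult)
  have i: "integrable std_normal_distribution (\<lambda>x. poly a x * poly b x)" for a b :: "real poly"
    using integrable_poly_std_normal[of "a * b"] by (simp add: poly_mult[abs_def])
  have "(\<lambda>x. x * poly (hermite n * q) x - poly (pderiv (hermite n * q)) x) =
     (\<lambda>x. poly (hermite (Suc n)) x * poly q x - poly (hermite n) x * poly (pderiv q) x)"
    by (auto simp: pderiv_mult algebra_simps)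
  with *[of "hermite n * q"] show ?thesis
    using i[of "hermite (Suc n)" q] i[of "hermite n" "pderiv q"] by simp
qed

text \<open>Differentiating the recursion gives He_n + x He_n' - He_n''. By induction He_n' = n
  He_(n-1), so the last two terms are n times the recursion for He_n itself.\<close>

lemma pderiv_hermite: "pderiv (hermite (Suc n)) = Polynomial.smult (of_nat (Suc n)) (hermite n)"
proof (induction n rule: less_induct)
  case (less n)
  show ?case
  proof (cases n)
    case 0 then show ?thesis by (simp add: pderiv_pCons)
  next
    case (Suc m)
    have "pderiv (hermite (Suc n)) =
      hermite n + pCons 0 (pderiv (hermite n)) - pderiv (pderiv (hermite n))"
      by (simp add: pderiv_diff pderiv_pCons)
    also have "\<dots> = hermite n + Polynomial.smult (of_nat n) (pCons 0 (hermite m) - pderiv (hermite m))"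
      using less[of m] Suc
      by (simp add: pderiv_smult smult_diff_right del: hermite.simps flip: add_diff_eq)
    also have "pCons 0 (hermite m) - pderiv (hermite m) = hermite n" using Suc by simp
    also have "hermite n + Polynomial.smult (of_nat n) (hermite n) = Polynomial.smult (of_nat (Suc n)) (hermite n)"
      by (simp add: smult_add_left del: hermite.simps)
    finally show ?thesis .
  qed
qed

lemma prob_space_std_normal: "prob_space std_normal_distribution"
  using prob_space_normal_density[of 1 0] by simp

text \<open>Each step lowers both degrees by one and contributes the degree as a factor. If the
  degrees differ, one side reaches a constant first and its derivative vanishes.\<close>

lemma hermite_orthogonal:
  "(LINT x|std_normal_distribution. poly (hermite n) x * poly (hermite m) x) =
    (if n = m then fact n else 0)"
proof (induction n arbitrary: m)
  case 0
  interpret prob_space std_normal_distribution by (rule prob_space_std_normal)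
  show ?case
  proof (cases m)
    case 0 then show ?thesis using prob_space by simp
  next
    case (Suc m')
    then show ?thesis using std_normal_hermite_Suc[of m' 1] by simp
  qed
next
  case (Suc n)
  show ?case
  proof (cases m)
    case 0
    then show ?thesis using std_normal_hermite_Suc[of n 1] by simp
  next
    case (Suc m')
    show ?thesis unfolding Suc std_normal_hermite_Suc pderiv_hermite
      using Suc.IH[of m'] by (simp add: mult.left_commute)
  qed
qed

lemma monic_hermite: "degree (hermite n) = n \<and> coeff (hermite n) n = 1"
proof (induction n)
  case (Suc n)
  then have "hermite n \<noteq> 0" by auto
  have 1: "degree (pCons 0 (hermite n)) = Suc n" using Suc \<open>hermite n \<noteq> 0\<close> by simp
  have 2: "degree (pderiv (hermite n)) < Suc n" using Suc degree_pderiv[of "hermite n"] by simp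
  have "degree (hermite (Suc n)) = Suc n" using 1 2
    by (metis degree_diff_less degree_add_eq_left degree_minus diff_conv_add_uminus hermite.simps(2))
  moreover have "coeff (hermite (Suc n)) (Suc n) = 1" using Suc 2 by (simp add: coeff_eq_0)
  ultimately show ?case by blast
qed simp

lemma hermite_expansion:
  assumes "degree p \<le> m"
  obtains c where "p = (\<Sum>b\<le>m. Polynomial.smult (c b) (hermite b))"
  using assms
proof (induction m arbitrary: p thesis)
  case 0
  show ?case by (rule "0.prems"(1)[of "\<lambda>_. coeff p 0"]) (use "0.prems"(2) in \<open>auto elim!: degree_eq_zeroE simp: one_pCons\<close>)
next
  case (Suc m)
  \<comment> \<open>Since \<open>hermite (Suc m)\<close> is monic, this multiple cancels the
    coefficient of degree \<open>Suc m\<close>.\<close>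
  define q where "q = p - Polynomial.smult (coeff p (Suc m)) (hermite (Suc m))"
  have "degree q \<le> m"
  proof (rule degree_le)
    show "\<forall>i>m. coeff q i = 0"
    proof (intro allI impI)
      fix i assume "m < i"
      then consider "i = Suc m" | "i > Suc m" by linarith
      then show "coeff q i = 0"
      proof cases
        case 1 then show ?thesis using monic_hermite[of "Suc m"] by (simp add: q_def del: hermite.simps)
      next
        case 2 then show ?thesis using monic_hermite[of "Suc m"] Suc.prems(2)
          by (simp add: q_def coeff_eq_0 del: hermite.simps)
      qed
    qed
  qed
  then obtain c where "q = (\<Sum>b\<le>m. Polynomial.smult (c b) (hermite b))" using Suc.IH by blast
  then have "p = (\<Sum>b\<le>Suc m. Polynomial.smult ((c(Suc m := coeff p (Suc m))) b) (hermite b))"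
    by (simp add: q_def diff_eq_eq del: hermite.simps)
  then show ?case using Suc.prems(1) by blast
qed

text \<open>Only the existence of the coefficients and the bound \<open>b \<le> m\<close> matter:
  later estimates involve the Hermite coefficients of the polynomial, never its monomial
  ones.\<close>

lemma monomial_hermite_expansion:
  obtains c :: "nat \<Rightarrow> nat \<Rightarrow> real" where "\<And>m x. x ^ m = (\<Sum>b\<le>m. c m b * poly (hermite b) x)"
proof -
  have "\<exists>c. \<forall>x. x ^ m = (\<Sum>b\<le>m. c b * poly (hermite b) x)" for m
  proof -
    have "degree (monom (1::real) m) \<le> m" by (simp add: degree_monom_eq)
    then obtain c where "monom (1::real) m = (\<Sum>b\<le>m. Polynomial.smult (c b) (hermite b))"
      by (rule hermite_expansion)
    then have "poly (monom (1::real) m) x = poly (\<Sum>b\<le>m. Polynomial.smult (c b) (hermite b)) x" for x by simp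
    then show ?thesis by (auto simp: poly_monom poly_sum)
  qed
  then obtain c where "\<And>m x. x ^ m = (\<Sum>b\<le>m. c m b * poly (hermite b) x)" by metis
  then show thesis by (rule that)
qed

section \<open>Centred Gaussians with a negative spike\<close>

lemma prob_space_PiM_std_normal: "prob_space (Pi\<^sub>M I (\<lambda>_. std_normal_distribution))"
  by (intro prob_space_PiM prob_space_std_normal)

text \<open>Rectangles determine a product measure, and over a rectangle both the density and the
  indicator are products, so the integral factorises.\<close>

lemma PiM_density:
  assumes "finite I" "product_sigma_finite M"
    and f[measurable]: "\<And>i. i \<in> I \<Longrightarrow> f i \<in> borel_measurable (M i)"
    and "product_sigma_finite (\<lambda>i. density (M i) (f i))"
  shows "density (Pi\<^sub>M I M) (\<lambda>x. \<Prod>i\<in>I. f i (x i)) = Pi\<^sub>M I (\<lambda>i. density (M i) (f i))"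
proof (rule product_sigma_finite.PiM_eqI[OF assms(4,1)])
  show "sets (density (Pi\<^sub>M I M) (\<lambda>x. \<Prod>i\<in>I. f i (x i))) = sets (Pi\<^sub>M I (\<lambda>i. density (M i) (f i)))"
    by (simp cong: sets_PiM_cong)
next
  fix A assume "\<And>i. i \<in> I \<Longrightarrow> A i \<in> sets (density (M i) (f i))"
  then have A[measurable]: "\<And>i. i \<in> I \<Longrightarrow> A i \<in> sets (M i)" by simp
  have m: "(\<lambda>x. \<Prod>i\<in>I. f i (x i)) \<in> borel_measurable (Pi\<^sub>M I M)"
    using \<open>finite I\<close> by measurable
  have "emeasure (density (Pi\<^sub>M I M) (\<lambda>x. \<Prod>i\<in>I. f i (x i))) (Pi\<^sub>E I A) =
     (\<integral>\<^sup>+x. (\<Prod>i\<in>I. f i (x i)) * indicator (Pi\<^sub>E I A) x \<partial>Pi\<^sub>M I M)"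
    using \<open>finite I\<close> by (intro emeasure_density m sets_PiM_I_finite A)
  also have "\<dots> = (\<integral>\<^sup>+x. (\<Prod>i\<in>I. f i (x i) * indicator (A i) (x i)) \<partial>Pi\<^sub>M I M)"
  proof (rule nn_integral_cong)
    fix x assume x: "x \<in> space (Pi\<^sub>M I M)"
    have "indicator (Pi\<^sub>E I A) x = (\<Prod>i\<in>I. indicator (A i) (x i) :: ennreal)"
      using x \<open>finite I\<close> by (auto simp: indicator_def space_PiM PiE_iff prod_zero_iff)
    then show "(\<Prod>i\<in>I. f i (x i)) * indicator (Pi\<^sub>E I A) x = (\<Prod>i\<in>I. f i (x i) * indicator (A i) (x i))"
      by (simp add: prod.distrib)
  qed
  also have "\<dots> = (\<Prod>i\<in>I. \<integral>\<^sup>+y. f i y * indicator (A i) y \<partial>M i)"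
    by (intro product_sigma_finite.product_nn_integral_prod assms(2) \<open>finite I\<close>) measurable
  also have "\<dots> = (\<Prod>i\<in>I. emeasure (density (M i) (f i)) (A i))"
    by (intro prod.cong refl) (simp add: emeasure_density)
  finally show "emeasure (density (Pi\<^sub>M I M) (\<lambda>x. \<Prod>i\<in>I. f i (x i))) (Pi\<^sub>E I A) =
    (\<Prod>i\<in>I. emeasure (density (M i) (f i)) (A i))" .
qed

lemma PiM_std_normal_eq_density:
  fixes I :: "'i set"
  assumes "finite I"
  shows "Pi\<^sub>M I (\<lambda>_. std_normal_distribution) =
    density (Pi\<^sub>M I (\<lambda>_. lborel)) (\<lambda>z. ennreal (\<Prod>i\<in>I. std_normal_density (z i)))"
proof -
  have "product_sigma_finite (\<lambda>_::'i. std_normal_distribution)"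
    by (simp add: product_sigma_finite_def prob_space_imp_sigma_finite prob_space_std_normal)
  moreover have "product_sigma_finite (\<lambda>_::'i. lborel :: real measure)"
    by (simp add: product_sigma_finite_def lborel.sigma_finite_measure_axioms)
  ultimately show ?thesis
    by (subst PiM_density[symmetric]) (auto simp: assms prod_ennreal)
qed

text \<open>Density of N(0, Id - \<theta> x x^T) relative to N(0, Id) for a unit vector x: the
  inverse covariance adds \<theta> / (1 - \<theta>) times x x^T to the identity, so only the
  projection of z on x enters.\<close>

definition spiked_likelihood :: "nat \<Rightarrow> real \<Rightarrow> real vec \<Rightarrow> (nat \<Rightarrow> real) \<Rightarrow> real" where
  "spiked_likelihood d \<theta> x z =
     exp (- (\<theta> / (1 - \<theta>)) * (\<Sum>j<d + 1. x $ j * z j)\<^sup>2 / 2) / sqrt (1 - \<theta>)"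

context
  fixes d :: nat and \<theta> :: real and x :: "real vec"
  assumes theta: "0 \<le> \<theta>" "\<theta> < 1"
    and x: "x \<in> carrier_vec (d + 1)" "(\<Sum>j<d + 1. (x $ j)\<^sup>2) = 1"
begin

text \<open>Both \<open>det (1 - V U)\<close> and \<open>det (1 - U V)\<close> are the determinant of the block matrix \<open>(1, U; V, 1)\<close>.\<close>

lemma det_spiked_cov: "det (spiked_cov d \<theta> x) = 1 - \<theta>"
proof -
  define m where "m = d + 1"
  define U where "U = mat 1 m (\<lambda>(_, j). \<theta> * x $ j)"
  define V where "V = mat m 1 (\<lambda>(i, _). x $ i)"
  have U: "U \<in> carrier_mat 1 m" and V: "V \<in> carrier_mat m 1" by (auto simp: U_def V_def)
  have VU: "1\<^sub>m m - V * U = spiked_cov d \<theta> x"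
    by (rule eq_matI) (auto simp: U_def V_def spiked_cov_def m_def scalar_prod_def)
  have UV: "(U * V) $$ (0, 0) = \<theta>"
    using x(2) by (simp add: U_def V_def scalar_prod_def m_def power2_eq_square mult.assoc
      lessThan_atLeast0 flip: sum_distrib_left)
  let ?I = "1\<^sub>m 1 :: real mat" and ?J = "1\<^sub>m m :: real mat"
  let ?L = "four_block_mat ?I (0\<^sub>m 1 m) V ?J"
  have L: "?L \<in> carrier_mat (1 + m) (1 + m)" using V by (intro four_block_carrier_mat) auto
  have detL: "det ?L = 1" using V by (subst det_four_block_mat_upper_right_zero) auto
  let ?A = "four_block_mat ?I U (0\<^sub>m m 1) (?J - V * U)"
  let ?B = "four_block_mat (?I - U * V) U (0\<^sub>m m 1) ?J"
  have A: "?A \<in> carrier_mat (1 + m) (1 + m)" and B: "?B \<in> carrier_mat (1 + m) (1 + m)"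
    using U V by (auto intro!: four_block_carrier_mat)
  have "?L * ?A = four_block_mat (?I * ?I + 0\<^sub>m 1 m * 0\<^sub>m m 1) (?I * U + 0\<^sub>m 1 m * (?J - V * U))
      (V * ?I + ?J * 0\<^sub>m m 1) (V * U + ?J * (?J - V * U))"
    by (rule mult_four_block_mat) (use U V in auto)
  also have "\<dots> = four_block_mat ?I U V ?J"
  proof -
    have "V * U + (?J - V * U) = ?J" by (rule eq_matI) (use U V in auto)
    then show ?thesis using U V by simp
  qed
  also have "\<dots> = four_block_mat ((?I - U * V) * ?I + U * V) ((?I - U * V) * 0\<^sub>m 1 m + U * ?J)
      (0\<^sub>m m 1 * ?I + ?J * V) (0\<^sub>m m 1 * 0\<^sub>m 1 m + ?J * ?J)"
  proof -
    have "(?I - U * V) + U * V = ?I" by (rule eq_matI) (use U V in auto)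
    then show ?thesis using U V by simp
  qed
  also have "\<dots> = ?B * ?L"
    by (rule mult_four_block_mat[symmetric]) (use U V in auto)
  finally have "det ?A = det ?B"
    using arg_cong[of "?L * ?A" "?B * ?L" det] det_mult[OF L A] det_mult[OF B L] detL by simp
  moreover have "det ?A = det (?J - V * U)"
    using U V by (subst det_four_block_mat_lower_left_zero) auto
  moreover have "det ?B = det (?I - U * V)"
    using U V by (subst det_four_block_mat_lower_left_zero) auto
  moreover have "det (?I - U * V) = 1 - \<theta>"
    using U V UV by (subst det_single) auto
  ultimately show ?thesis using VU by simp
qed

text \<open>For a unit vector, X = x x^T is idempotent, so (1 - \<theta> X) (1 + c X) = 1 + (c (1 -
  \<theta>) - \<theta>) X, and c = \<theta> / (1 - \<theta>) removes the last term (the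
  Sherman--Morrison formula).\<close>

lemma mat_inverse_spiked_cov:
  "mat_inverse (spiked_cov d \<theta> x) =
     Some (1\<^sub>m (d + 1) + (\<theta> / (1 - \<theta>)) \<cdot>\<^sub>m mat (d + 1) (d + 1) (\<lambda>(i, j). x $ i * x $ j))"
proof -
  define m where "m = d + 1"
  define X where "X = mat m m (\<lambda>(i, j). x $ i * x $ j)"
  define c where "c = \<theta> / (1 - \<theta>)"
  let ?S = "spiked_cov d \<theta> x" and ?C = "1\<^sub>m m + c \<cdot>\<^sub>m X"
  have X: "X \<in> carrier_mat m m" by (simp add: X_def)
  have S: "?S = 1\<^sub>m m - \<theta> \<cdot>\<^sub>m X" by (simp add: spiked_cov_def X_def m_def)
  have Sc: "?S \<in> carrier_mat m m" and Cc: "?C \<in> carrier_mat m m" using X unfolding S by auto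
  have XX: "X * X = X"
  proof (rule eq_matI)
    fix i j assume ij: "i < dim_row X" "j < dim_col X"
    then have "(X * X) $$ (i, j) = (\<Sum>l<m. (x $ i * x $ j) * (x $ l)\<^sup>2)"
      by (auto simp: X_def scalar_prod_def lessThan_atLeast0 power2_eq_square mult_ac intro!: sum.cong)
    also have "\<dots> = X $$ (i, j)" using ij x(2) by (simp add: X_def m_def flip: sum_distrib_left)
    finally show "(X * X) $$ (i, j) = X $$ (i, j)" .
  qed (auto simp: X_def)
  have SC: "?S * ?C = 1\<^sub>m m"
  proof -
    have "?S * ?C = ?S * 1\<^sub>m m + ?S * (c \<cdot>\<^sub>m X)"
      using X Sc by (intro mult_add_distrib_mat) auto
    also have "?S * (c \<cdot>\<^sub>m X) = c \<cdot>\<^sub>m (?S * X)" using X Sc by (intro mult_smult_distrib)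
    also have "?S * X = 1\<^sub>m m * X - (\<theta> \<cdot>\<^sub>m X) * X"
      unfolding S using X by (intro minus_mult_distrib_mat) auto
    also have "(\<theta> \<cdot>\<^sub>m X) * X = \<theta> \<cdot>\<^sub>m X" using X XX mult_smult_assoc_mat[OF X X, of \<theta>] by simp
    also have "?S * 1\<^sub>m m = 1\<^sub>m m - \<theta> \<cdot>\<^sub>m X"
      by (subst right_mult_one_mat[OF Sc]) (rule S)
    also have "1\<^sub>m m - \<theta> \<cdot>\<^sub>m X + c \<cdot>\<^sub>m (1\<^sub>m m * X - \<theta> \<cdot>\<^sub>m X) = 1\<^sub>m m"
    proof (rule eq_matI)
      fix i j assume "i < dim_row (1\<^sub>m m :: real mat)" "j < dim_col (1\<^sub>m m :: real mat)"
      then have ij: "i < m" "j < m" by auto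
      have "- \<theta> + c * (1 - \<theta>) = 0" using theta by (simp add: c_def)
      then have "(- \<theta> + c * (1 - \<theta>)) * X $$ (i, j) = 0" by simp
      then have "- \<theta> * X $$ (i, j) + c * (X $$ (i, j) - \<theta> * X $$ (i, j)) = 0"
        by (simp add: algebra_simps)
      then show "(1\<^sub>m m - \<theta> \<cdot>\<^sub>m X + c \<cdot>\<^sub>m (1\<^sub>m m * X - \<theta> \<cdot>\<^sub>m X)) $$ (i, j) = 1\<^sub>m m $$ (i, j)"
        using ij X by simp
    qed (use X in auto)
    finally show ?thesis .
  qed
  \<comment> \<open>The determinant only guarantees that \<open>mat_inverse\<close> returns some
    left inverse \<open>B\<close>; it equals \<open>?C\<close> because \<open>?C\<close> is a right
    inverse.\<close>
  have "?S \<in> Units (ring_mat TYPE(real) m ())"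
    by (rule det_non_zero_imp_unit[OF Sc]) (use det_spiked_cov theta in simp)
  then obtain B where B: "mat_inverse ?S = Some B" 
    using mat_inverse(1)[OF Sc, where b = "()"] by (cases "mat_inverse ?S") auto
  from mat_inverse(2)[OF Sc this] have B': "B * ?S = 1\<^sub>m m" "B \<in> carrier_mat m m" by auto
  have "B = B * (?S * ?C)" using SC B' by simp
  also have "\<dots> = (B * ?S) * ?C" by (rule assoc_mult_mat[symmetric, OF B'(2) Sc Cc])
  also have "\<dots> = ?C" unfolding B'(1) by (rule left_mult_one_mat[OF Cc])
  finally show ?thesis using B by (simp add: X_def c_def m_def)
qed

lemma mv_normal_spiked_cov:
  "mv_normal (d + 1) (spiked_cov d \<theta> x) =
     density (Pi\<^sub>M {..<d + 1} (\<lambda>_. std_normal_distribution)) (\<lambda>z. ennreal (spiked_likelihood d \<theta> x z))"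
proof -
  define m where "m = d + 1"
  define c where "c = \<theta> / (1 - \<theta>)"
  let ?B = "1\<^sub>m m + c \<cdot>\<^sub>m mat m m (\<lambda>(i, j). x $ i * x $ j)"
  have quad: "vec m z \<bullet> (?B *\<^sub>v vec m z) = (\<Sum>j<m. (z j)\<^sup>2) + c * (\<Sum>j<m. x $ j * z j)\<^sup>2" for z
  proof -
    have *: "(?B *\<^sub>v vec m z) $ i = z i + c * (x $ i * (\<Sum>j<m. x $ j * z j))" if "i < m" for i
    proof -
      have "(?B *\<^sub>v vec m z) $ i = (\<Sum>j<m. ((if i = j then 1 else 0) + c * (x $ i * x $ j)) * z j)"
        using that by (auto simp: scalar_prod_def lessThan_atLeast0 intro!: sum.cong)
      also have "\<dots> = (\<Sum>j<m. (if i = j then z j else 0) + c * (x $ i * (x $ j * z j)))"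
        by (intro sum.cong) (auto simp: algebra_simps)
      also have "\<dots> = z i + c * (x $ i * (\<Sum>j<m. x $ j * z j))"
        using that by (simp add: sum.distrib sum_distrib_left)
      finally show ?thesis .
    qed
    have "vec m z \<bullet> (?B *\<^sub>v vec m z) = (\<Sum>i<m. z i * (?B *\<^sub>v vec m z) $ i)"
      by (simp add: scalar_prod_def lessThan_atLeast0)
    also have "\<dots> = (\<Sum>i<m. (z i)\<^sup>2 + c * ((x $ i * z i) * (\<Sum>j<m. x $ j * z j)))"
      by (rule sum.cong[OF refl]) (subst *, auto simp: power2_eq_square algebra_simps)
    also have "\<dots> = (\<Sum>j<m. (z j)\<^sup>2) + c * (\<Sum>j<m. x $ j * z j)\<^sup>2"
      by (simp add: sum.distrib power2_eq_square flip: sum_distrib_left sum_distrib_right)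
    finally show ?thesis .
  qed
  have dens: "exp (- (vec m z \<bullet> (?B *\<^sub>v vec m z)) / 2) / sqrt ((2 * pi) ^ m * (1 - \<theta>)) =
     (\<Prod>i<m. std_normal_density (z i)) * spiked_likelihood d \<theta> x z" for z
  proof -
    have "(\<Prod>i<m. std_normal_density (z i)) = exp (- (\<Sum>i<m. (z i)\<^sup>2) / 2) / sqrt (2 * pi) ^ m"
      by (simp add: normal_density_def prod_dividef sum_negf sum_divide_distrib flip: exp_sum)
    moreover have "exp (- (S + c * u) / 2) / sqrt ((2 * pi) ^ m * (1 - \<theta>)) =
        exp (- S / 2) / sqrt (2 * pi) ^ m * (exp (- c * u / 2) / sqrt (1 - \<theta>))" for S u
      by (simp add: real_sqrt_mult real_sqrt_power power_mult_distrib diff_divide_distrib flip: exp_add)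
    ultimately show ?thesis unfolding quad by (simp only: spiked_likelihood_def flip: m_def c_def)
  qed
  have "mv_normal m (spiked_cov d \<theta> x) = density (Pi\<^sub>M {..<m} (\<lambda>_. lborel))
      (\<lambda>z. ennreal (\<Prod>i<m. std_normal_density (z i)) * ennreal (spiked_likelihood d \<theta> x z))"
    unfolding mv_normal_def mat_inverse_spiked_cov[folded m_def c_def] det_spiked_cov option.sel dens
    by (simp add: ennreal_mult' prod_nonneg)
  also have "\<dots> = density (density (Pi\<^sub>M {..<m} (\<lambda>_. lborel))
      (\<lambda>z. ennreal (\<Prod>i<m. std_normal_density (z i)))) (\<lambda>z. ennreal (spiked_likelihood d \<theta> x z))"
    by (rule density_density_eq[symmetric]) (simp_all add: spiked_likelihood_def m_def)
  finally show ?thesis by (simp add: PiM_std_normal_eq_density m_def)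
qed

end

text \<open>The null covariance is the spiked one with \<theta> = 0 and an arbitrary unit vector;
  this is why the preceding lemmas admit \<theta> = 0.\<close>

lemma mv_normal_one: "mv_normal (d + 1) (1\<^sub>m (d + 1)) = Pi\<^sub>M {..<d + 1} (\<lambda>_. std_normal_distribution)"
proof -
  define x :: "real vec" where "x = unit_vec (d + 1) 0"
  have "spiked_cov d 0 x = 1\<^sub>m (d + 1)"
    by (rule eq_matI) (auto simp: spiked_cov_def)
  moreover have "(\<Sum>j<d + 1. (x $ j)\<^sup>2) = 1"
    by (simp add: x_def unit_vec_def if_distrib[of "\<lambda>y. y\<^sup>2"] cong: if_cong)
  ultimately show ?thesis
    using mv_normal_spiked_cov[of 0 x d] by (simp add: x_def spiked_likelihood_def density_1)
qed

section \<open>Hermite coefficients of a spiked Gaussian\<close>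

text \<open>The mean of the Hermite polynomial of degree M under N(0, 1 - \<theta>), that is, M!
  times the coefficient of t^M in exp(- \<theta> t^2 / 2). It is the w of the overview.\<close>

definition spiked_coeff :: "real \<Rightarrow> nat \<Rightarrow> real" where
  "spiked_coeff \<theta> M =
     (if even M then (- \<theta> / 2) ^ (M div 2) * fact M / fact (M div 2) else 0)"

lemma borel_measurable_poly[measurable]: "poly (p :: real poly) \<in> borel_measurable borel"
  by (intro borel_measurable_continuous_onI continuous_intros)

text \<open>Because 1 + \<theta> / (1 - \<theta>) = 1 / (1 - \<theta>), the tilted density is sqrt(1
  - \<theta>) times that of N(0, 1 - \<theta>), whose moments are explicit.\<close>

lemma std_normal_tilted_moment:
  assumes "0 \<le> \<theta>" "\<theta> < 1"
  shows "(LINT g|std_normal_distribution. g ^ M * exp (- (\<theta> / (1 - \<theta>)) * g\<^sup>2 / 2)) =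
    (if even M then sqrt (1 - \<theta>) * (fact M / ((2 / (1 - \<theta>)) ^ (M div 2) * fact (M div 2))) else 0)"
proof -
  define \<sigma> where "\<sigma> = sqrt (1 - \<theta>)"
  have \<sigma>: "\<sigma> > 0" "\<sigma>\<^sup>2 = 1 - \<theta>" using assms by (auto simp: \<sigma>_def)
  have *: "std_normal_density g * exp (- (\<theta> / (1 - \<theta>)) * g\<^sup>2 / 2) = \<sigma> * normal_density 0 \<sigma> g" for g
  proof -
    have "- g\<^sup>2 / 2 + - (\<theta> / (1 - \<theta>)) * g\<^sup>2 / 2 = - g\<^sup>2 / (2 * \<sigma>\<^sup>2)"
      using assms \<sigma>(2) by (simp add: divide_simps) (simp add: algebra_simps)
    then have "exp (- g\<^sup>2 / 2) * exp (- (\<theta> / (1 - \<theta>)) * g\<^sup>2 / 2) = exp (- g\<^sup>2 / (2 * \<sigma>\<^sup>2))"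
      by (simp only: exp_add[symmetric])
    then show ?thesis using \<sigma>(1) by (simp add: normal_density_def real_sqrt_mult)
  qed
  have "(LINT g|std_normal_distribution. g ^ M * exp (- (\<theta> / (1 - \<theta>)) * g\<^sup>2 / 2)) =
    (LINT g|lborel. std_normal_density g *\<^sub>R (g ^ M * exp (- (\<theta> / (1 - \<theta>)) * g\<^sup>2 / 2)))"
    by (rule integral_density) auto
  also have "\<dots> = (LINT g|lborel. \<sigma> * (normal_density 0 \<sigma> g * g ^ M))"
    by (rule Bochner_Integration.integral_cong) (use * in \<open>simp_all add: mult_ac\<close>)
  also have "\<dots> = \<sigma> * (LINT g|lborel. normal_density 0 \<sigma> g * (g - 0) ^ M)" by simp
  also have "(LINT g|lborel. normal_density 0 \<sigma> g * (g - 0) ^ M) =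
     (if even M then fact M / ((2 / (1 - \<theta>)) ^ (M div 2) * fact (M div 2)) else 0)"
  proof (cases "even M")
    case True
    then obtain l where "M = 2 * l" by blast
    then show ?thesis using integral_normal_moment_even[OF \<sigma>(1), of 0 l] \<sigma>(2) by simp
  next
    case False
    then obtain l where "M = 2 * l + 1" by (rule oddE)
    then show ?thesis using integral_normal_moment_odd[OF \<sigma>(1), of 0 l] by simp
  qed
  finally show ?thesis by (simp add: \<sigma>_def)
qed

lemma product_sigma_finite_std_normal: "product_sigma_finite (\<lambda>_. std_normal_distribution)"
  by (simp add: product_sigma_finite_def prob_space_imp_sigma_finite prob_space_std_normal)

context
  fixes d :: nat and \<theta> :: real and x :: "real vec"
  assumes theta: "0 \<le> \<theta>" "\<theta> < 1"
    and x: "x \<in> carrier_vec (d + 1)" "(\<Sum>j<d + 1. (x $ j)\<^sup>2) = 1"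
begin

text \<open>For a negative spike the exponent of the likelihood is nonpositive, so the likelihood is
  bounded and integrability under the null law suffices.\<close>

lemma integrable_likelihood_hermite:
  "integrable (Pi\<^sub>M {..<d + 1} (\<lambda>_. std_normal_distribution))
    (\<lambda>z. spiked_likelihood d \<theta> x z * (\<Prod>j<d + 1. poly (hermite (a j)) (z j)))"
proof -
  have "integrable (Pi\<^sub>M {..<d + 1} (\<lambda>_. std_normal_distribution))
    (\<lambda>z. (\<Prod>j<d + 1. poly (hermite (a j)) (z j)))"
    by (rule product_sigma_finite.product_integrable_prod[OF product_sigma_finite_std_normal])
       (auto intro: integrable_poly_std_normal)
  then have i: "integrable (Pi\<^sub>M {..<d + 1} (\<lambda>_. std_normal_distribution))
    (\<lambda>z. 1 / sqrt (1 - \<theta>) * (\<Prod>j<d + 1. poly (hermite (a j)) (z j)))"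
    by (rule integrable_mult_right)
  show ?thesis
  proof (rule Bochner_Integration.integrable_bound[OF i])
    show "(\<lambda>z. spiked_likelihood d \<theta> x z * (\<Prod>j<d + 1. poly (hermite (a j)) (z j)))
      \<in> borel_measurable (Pi\<^sub>M {..<d + 1} (\<lambda>_. std_normal_distribution))"
      unfolding spiked_likelihood_def by measurable
    have "\<bar>spiked_likelihood d \<theta> x z\<bar> \<le> 1 / sqrt (1 - \<theta>)" for z
      using theta unfolding spiked_likelihood_def abs_divide
      by (intro frac_le) (auto intro!: mult_nonneg_nonneg divide_nonneg_nonneg)
    then show "AE z in Pi\<^sub>M {..<d + 1} (\<lambda>_. std_normal_distribution).
       norm (spiked_likelihood d \<theta> x z * (\<Prod>j<d + 1. poly (hermite (a j)) (z j))) \<le>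
       norm (1 / sqrt (1 - \<theta>) * (\<Prod>j<d + 1. poly (hermite (a j)) (z j)))"
      using theta unfolding real_norm_def abs_mult
      by (intro AE_I2 mult_right_mono) auto
  qed
qed

lemma integrable_spiked_hermite:
  "integrable (mv_normal (d + 1) (spiked_cov d \<theta> x)) (\<lambda>z. \<Prod>j<d + 1. poly (hermite (a j)) (z j))"
  unfolding mv_normal_spiked_cov[OF theta x]
  using integrable_likelihood_hermite[of a] theta
  by (subst integrable_density) (auto simp: spiked_likelihood_def[abs_def] simp del: prod.lessThan_Suc)

text \<open>
  Writing \<open>exp (- c u\<^sup>2 / 2)\<close> as \<open>E exp (\<i> \<surd>c g u)\<close> with \<open>g\<close> standard normal makes the likelihood factorise
  over the coordinates once \<open>g\<close> is fixed.
\<close>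

lemma spiked_hermite_expectation:
  "(LINT z|mv_normal (d + 1) (spiked_cov d \<theta> x). (\<Prod>j<d + 1. poly (hermite (a j)) (z j))) =
     spiked_coeff \<theta> (\<Sum>j<d + 1. a j) * (\<Prod>j<d + 1. (x $ j) ^ a j)"
proof -
  define m where "m = d + 1"
  define N where "N = std_normal_distribution"
  define Q where "Q = Pi\<^sub>M {..<m} (\<lambda>_. N)"
  define c where "c = \<theta> / (1 - \<theta>)"
  define r where "r = sqrt c"
  define u where "u z = (\<Sum>j<m. x $ j * z j)" for z :: "nat \<Rightarrow> real"
  define H where "H z = (\<Prod>j<m. poly (hermite (a j)) (z j))" for z :: "nat \<Rightarrow> real"
  define F where "F z g = complex_of_real (H z) * iexp (r * u z * g)" for z g
  define M where "M = (\<Sum>j<m. a j)"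
  define X where "X = (\<Prod>j<m. (x $ j) ^ a j)"
  have c: "c \<ge> 0" "r\<^sup>2 = c" using theta by (auto simp: c_def r_def)
  have sets_N[measurable_cong]: "sets N = sets borel" by (simp add: N_def)
  interpret N: prob_space N unfolding N_def by (rule prob_space_std_normal)
  interpret PN: product_sigma_finite "\<lambda>_::nat. N" unfolding N_def by (rule product_sigma_finite_std_normal)
  interpret Q: prob_space Q unfolding Q_def N_def by (rule prob_space_PiM_std_normal)
  interpret QN: pair_sigma_finite Q N by standard
  have H_meas[measurable]: "H \<in> borel_measurable Q" unfolding H_def Q_def by measurable
  have u_meas[measurable]: "u \<in> borel_measurable Q" unfolding u_def Q_def by measurable
  have intH: "integrable Q H" unfolding H_def Q_def
    by (rule PN.product_integrable_prod) (auto simp: N_def intro: integrable_poly_std_normal)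
  have char: "(LINT g|N. iexp (r * t * g)) = of_real (exp (- c * t\<^sup>2 / 2))" for t
    using fun_cong[OF char_std_normal_distribution, of "r * t"] c
    by (simp add: char_def N_def power_mult_distrib)
  \<comment> \<open>The exponential has modulus 1, so the joint integrability reduces to that of
    \<open>H\<close>.\<close>
  have Fub: "integrable (Q \<Otimes>\<^sub>M N) (case_prod F)"
  proof (rule QN.Fubini_integrable)
    show "case_prod F \<in> borel_measurable (Q \<Otimes>\<^sub>M N)"
      unfolding F_def by measurable
    show "integrable Q (\<lambda>z. LINT g|N. norm (case_prod F (z, g)))"
      using intH by (simp add: F_def norm_mult N.prob_space)
    show "AE z in Q. integrable N (\<lambda>g. case_prod F (z, g))"
    proof (rule AE_I2)
      fix z
      show "integrable N (\<lambda>g. case_prod F (z, g))"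
        by (rule N.integrable_const_bound[of _ "norm (H z)"])
           (auto simp: F_def norm_mult)
    qed
  qed
  \<comment> \<open>For fixed g each coordinate is a Hermite Fourier transform at frequency r g
    x_j.\<close>
  have inner: "(LINT z|Q. F z g) =
    (\<i> * r) ^ M * of_real X * of_real (g ^ M * exp (- c * g\<^sup>2 / 2))" for g
  proof -
    have "F z g = (\<Prod>j<m. of_real (poly (hermite (a j)) (z j)) * iexp ((r * g * x $ j) * z j))" for z
      by (simp add: F_def H_def u_def prod.distrib sum_distrib_left sum_distrib_right mult_ac flip: exp_sum)
    then have "(LINT z|Q. F z g) =
       (\<Prod>j<m. LINT y|N. of_real (poly (hermite (a j)) y) * iexp ((r * g * x $ j) * y))"
    proof (simp only: Q_def, intro PN.product_integral_prod)
      fix j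
      show "integrable N (\<lambda>y. complex_of_real (poly (hermite (a j)) y) * iexp (r * g * x $ j * y))"
        by (rule Bochner_Integration.integrable_bound[OF integrable_poly_std_normal[of "hermite (a j)", folded N_def]])
           (auto simp: norm_mult)
    qed auto
    also have "\<dots> = (\<Prod>j<m. (\<i> * (r * g * x $ j)) ^ a j * of_real (exp (- (r * g * x $ j)\<^sup>2 / 2)))"
      unfolding N_def by (intro prod.cong refl) (simp only: hermite_fourier)
    also have "\<dots> = (\<Prod>j<m. (\<i> * r) ^ a j * of_real (x $ j) ^ a j * of_real g ^ a j) *
        of_real (\<Prod>j<m. exp (- (r * g * x $ j)\<^sup>2 / 2))"
      by (simp add: prod.distrib power_mult_distrib mult_ac)
    \<comment> \<open>The unit norm of x merges the Gaussian factors of all coordinates into a tilt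
      of g alone.\<close>
    also have "(\<Prod>j<m. exp (- (r * g * x $ j)\<^sup>2 / 2)) = exp (- c * g\<^sup>2 / 2)"
    proof -
      have "(\<Sum>j<m. - (r * g * x $ j)\<^sup>2 / 2) = (- (c * g\<^sup>2) / 2) * (\<Sum>j<m. (x $ j)\<^sup>2)"
        using c(2) by (simp add: power_mult_distrib sum_distrib_left sum_negf sum_divide_distrib mult_ac)
      also have "\<dots> = - c * g\<^sup>2 / 2" using x(2) by (simp add: m_def del: sum.lessThan_Suc)
      finally show ?thesis by (simp flip: exp_sum)
    qed
    also have "(\<Prod>j<m. (\<i> * r) ^ a j * of_real (x $ j) ^ a j * of_real g ^ a j) =
       (\<i> * r) ^ M * of_real X * of_real (g ^ M)"
      by (simp add: prod.distrib M_def X_def power_sum)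
    finally show ?thesis by simp
  qed
  have "complex_of_real (LINT z|Q. spiked_likelihood d \<theta> x z * H z) =
     (LINT z|Q. complex_of_real (spiked_likelihood d \<theta> x z * H z))"
    by (rule integral_complex_of_real[symmetric])
  also have "\<dots> = (LINT z|Q. of_real (1 / sqrt (1 - \<theta>)) * (LINT g|N. F z g))"
  proof (rule Bochner_Integration.integral_cong[OF refl])
    fix z
    have "spiked_likelihood d \<theta> x z = 1 / sqrt (1 - \<theta>) * exp (- c * (u z)\<^sup>2 / 2)"
      by (simp add: spiked_likelihood_def u_def c_def m_def del: sum.lessThan_Suc)
    then show "complex_of_real (spiked_likelihood d \<theta> x z * H z) =
        of_real (1 / sqrt (1 - \<theta>)) * (LINT g|N. F z g)"
      unfolding F_def integral_mult_right_zero char by simp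
  qed
  also have "\<dots> = of_real (1 / sqrt (1 - \<theta>)) * (LINT z|Q. LINT g|N. F z g)" by simp
  also have "(LINT z|Q. LINT g|N. F z g) = (LINT g|N. LINT z|Q. F z g)"
    by (rule QN.Fubini_integral[OF Fub, symmetric])
  also have "\<dots> = (\<i> * r) ^ M * of_real X * of_real (LINT g|N. g ^ M * exp (- c * g\<^sup>2 / 2))"
    unfolding inner by (simp add: mult.assoc del: of_real_mult)
  also have "(LINT g|N. g ^ M * exp (- c * g\<^sup>2 / 2)) =
    (if even M then sqrt (1 - \<theta>) * (fact M / ((2 / (1 - \<theta>)) ^ (M div 2) * fact (M div 2))) else 0)"
    unfolding N_def c_def by (rule std_normal_tilted_moment[OF theta])
  also have "of_real (1 / sqrt (1 - \<theta>)) * ((\<i> * r) ^ M * of_real X * of_real \<dots>) =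
     complex_of_real (spiked_coeff \<theta> M * X)"
  proof (cases "even M")
    case True
    then obtain l where l: "M = 2 * l" by blast
    have "(\<i> * complex_of_real r)\<^sup>2 = of_real (- c)"
      using c(2) by (simp add: power_mult_distrib flip: of_real_power)
    then have "(\<i> * complex_of_real r) ^ M = of_real ((- c) ^ l)"
      by (simp only: l power_mult of_real_power)
    \<comment> \<open>Since c (1 - \<theta>) = \<theta>, the variance of the tilted variable cancels
      the denominator of c.\<close>
    moreover have AB: "(- c) ^ l / (2 / (1 - \<theta>)) ^ l = (- \<theta> / 2) ^ l"
      using theta by (simp add: c_def flip: power_divide)
    have gen: "1 / sqrt (1 - \<theta>) * (A * X * (sqrt (1 - \<theta>) * (F / (B * G)))) = A / B * F / G * X"
      for A B F G :: real using theta by simp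
    have "1 / sqrt (1 - \<theta>) * ((- c) ^ l * X * (sqrt (1 - \<theta>) * (fact M / ((2 / (1 - \<theta>)) ^ l * fact l)))) =
        spiked_coeff \<theta> M * X"
      unfolding gen AB using True l by (simp add: spiked_coeff_def)
    ultimately show ?thesis using True l
      by (simp only: if_True nonzero_mult_div_cancel_left[OF zero_neq_numeral[symmetric]] flip: of_real_mult)
  qed (simp add: spiked_coeff_def)
  finally have *: "(LINT z|Q. spiked_likelihood d \<theta> x z * H z) = spiked_coeff \<theta> M * X"
    by (simp only: of_real_eq_iff)
  have "(LINT z|mv_normal (d + 1) (spiked_cov d \<theta> x). H z) =
     (LINT z|Q. spiked_likelihood d \<theta> x z *\<^sub>R H z)"
    unfolding mv_normal_spiked_cov[OF theta x] Q_def m_def N_def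
    using H_meas theta unfolding Q_def m_def N_def
    by (intro integral_density) (auto simp: spiked_likelihood_def[abs_def])
  with * show ?thesis by (simp add: H_def M_def X_def m_def)
qed

text \<open>The total mass is the Hermite expectation with all degrees 0. Integrability of the
  constant 1 is what excludes infinite mass, for which \<open>measure\<close> would be
  meaningless.\<close>

lemma prob_space_spiked: "prob_space (mv_normal (d + 1) (spiked_cov d \<theta> x))" (is "prob_space ?P")
proof (rule prob_spaceI)
  have "integrable ?P (\<lambda>_. 1 :: real)" and 1: "(LINT z|?P. 1) = (1 :: real)"
    using integrable_spiked_hermite[of "\<lambda>_. 0"] spiked_hermite_expectation[of "\<lambda>_. 0"]
    by (simp_all add: spiked_coeff_def)
  then have "emeasure ?P (space ?P) < \<infinity>" by (simp add: integrable_iff_bounded)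
  then have "emeasure ?P (space ?P) = ennreal (measure ?P (space ?P))"
    by (intro emeasure_eq_ennreal_measure) auto
  then show "emeasure ?P (space ?P) = 1" using 1 by simp
qed

end

text \<open>For M = 2 l the quotient by M! is (\<theta>^2 / 4)^l times the central binomial
  coefficient, which is at most 4^l. The resulting bound is uniform in \<theta>.\<close>

lemma spiked_coeff_sq_le:
  assumes "0 \<le> \<theta>" "\<theta> \<le> 1"
  shows "(spiked_coeff \<theta> M)\<^sup>2 \<le> (if even M then fact M else 0)"
proof (cases "even M")
  case True
  then obtain l where l: "M = 2 * l" by blast
  have "((2 * l) choose l) \<le> 2 ^ (2 * l)" by (rule binomial_le_pow2)
  moreover have "real ((2 * l) choose l) = fact (2 * l) / (fact l * fact l)"
    using binomial_fact[of l "2 * l", where 'a = real] by simp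
  ultimately have b: "fact (2 * l) / (fact l * fact l) \<le> (4 ^ l :: real)"
    by (metis of_nat_le_iff of_nat_numeral of_nat_power power2_eq_square power_mult
        num_double numeral_times_numeral)
  have "(spiked_coeff \<theta> M)\<^sup>2 = \<theta> ^ (2 * l) / 4 ^ l * (fact (2 * l) / (fact l * fact l)) * fact (2 * l)"
    by (simp add: spiked_coeff_def l power_mult_distrib power_divide power2_eq_square field_simps
        power_mult flip: power_mult_distrib)
  also have "\<dots> \<le> 1 / 4 ^ l * 4 ^ l * fact (2 * l)"
    using assms b by (intro mult_mono divide_right_mono power_le_one) auto
  finally show ?thesis by (simp add: l)
qed (simp add: spiked_coeff_def)

section \<open>Compositions and multinomial sums\<close>

text \<open>Parts may be 0. Extensionality makes each composition occur once, so that the set is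
  finite.\<close>

definition compositions :: "'i set \<Rightarrow> nat \<Rightarrow> ('i \<Rightarrow> nat) set" where
  "compositions I M = {a \<in> I \<rightarrow>\<^sub>E UNIV. (\<Sum>i\<in>I. a i) = M}"

lemma compositions_subset_PiE:
  assumes "finite I"
  shows "compositions I M \<subseteq> I \<rightarrow>\<^sub>E {..M}"
proof
  fix a assume a: "a \<in> compositions I M"
  have "a i \<le> M" if "i \<in> I" for i
    using a member_le_sum[OF that, of a] assms by (auto simp: compositions_def)
  then show "a \<in> I \<rightarrow>\<^sub>E {..M}" using a by (auto simp: compositions_def PiE_iff)
qed

lemma finite_compositions: "finite I \<Longrightarrow> finite (compositions I M)"
  by (rule finite_subset[OF compositions_subset_PiE]) (auto intro: finite_PiE)

lemma sum_compositions_insert: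
  fixes f :: "'i \<Rightarrow> nat \<Rightarrow> real"
  assumes I: "finite I" "j \<notin> I"
  shows "(\<Sum>a\<in>compositions (insert j I) M. \<Prod>i\<in>insert j I. f i (a i)) =
    (\<Sum>l\<le>M. f j l * (\<Sum>a\<in>compositions I (M - l). \<Prod>i\<in>I. f i (a i)))"
proof -
  have "(\<Sum>l\<le>M. f j l * (\<Sum>a\<in>compositions I (M - l). \<Prod>i\<in>I. f i (a i))) =
     (\<Sum>(l, a)\<in>(SIGMA l:{..M}. compositions I (M - l)). f j l * (\<Prod>i\<in>I. f i (a i)))"
    unfolding sum_distrib_left by (rule sum.Sigma) (auto simp: I finite_compositions)
  \<comment> \<open>Split off the part at \<open>j\<close>; resetting it to \<open>undefined\<close>
    keeps the remainder extensional on \<open>I\<close>.\<close>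
  also have "\<dots> = (\<Sum>a\<in>compositions (insert j I) M. \<Prod>i\<in>insert j I. f i (a i))"
  proof (rule sum.reindex_bij_witness[where j = "\<lambda>(l, a). a(j := l)" and i = "\<lambda>a. (a j, a(j := undefined))"])
    fix p assume p: "p \<in> (SIGMA l:{..M}. compositions I (M - l))"
    obtain l a where la: "p = (l, a)" by force
    have s: "(\<Sum>i\<in>I. (a(j := l)) i) = (\<Sum>i\<in>I. a i)" using I by (intro sum.cong) auto
    show "(case p of (l, a) \<Rightarrow> a(j := l)) \<in> compositions (insert j I) M"
      using p la s I by (auto simp: compositions_def PiE_iff extensional_def)
    show "((case p of (l, a) \<Rightarrow> a(j := l)) j, (case p of (l, a) \<Rightarrow> a(j := l))(j := undefined)) = p"
      using p la I by (auto simp: compositions_def PiE_iff extensional_def)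
    have "(\<Prod>i\<in>I. f i ((a(j := l)) i)) = (\<Prod>i\<in>I. f i (a i))" using I by (intro prod.cong) auto
    then show "(\<Prod>i\<in>insert j I. f i ((case p of (l, a) \<Rightarrow> a(j := l)) i)) =
       (case p of (l, a) \<Rightarrow> f j l * (\<Prod>i\<in>I. f i (a i)))"
      using la I by simp
  next
    fix a assume a: "a \<in> compositions (insert j I) M"
    have s: "(\<Sum>i\<in>I. (a(j := undefined)) i) = (\<Sum>i\<in>I. a i)" using I by (intro sum.cong) auto
    show "(a j, a(j := undefined)) \<in> (SIGMA l:{..M}. compositions I (M - l))"
      using a s I by (auto simp: compositions_def PiE_iff extensional_def)
  qed auto
  finally show ?thesis by simp
qed

text \<open>The multinomial theorem divided by M!; with this normalisation adding an index is a
  convolution, evaluated by the binomial theorem.\<close>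

lemma multinomial_compositions:
  fixes y :: "'i \<Rightarrow> real"
  assumes "finite I"
  shows "(\<Sum>a\<in>compositions I M. \<Prod>i\<in>I. y i ^ a i / fact (a i)) = (\<Sum>i\<in>I. y i) ^ M / fact M"
  using assms
proof (induction I arbitrary: M rule: finite_induct)
  case empty
  then show ?case by (cases M) (auto simp: compositions_def)
next
  case (insert j I)
  have "(\<Sum>a\<in>compositions (insert j I) M. \<Prod>i\<in>insert j I. y i ^ a i / fact (a i)) =
    (\<Sum>l\<le>M. y j ^ l / fact l * ((\<Sum>i\<in>I. y i) ^ (M - l) / fact (M - l)))"
    by (subst sum_compositions_insert[OF insert.hyps]) (simp add: insert.IH)
  also have "\<dots> = (\<Sum>l\<le>M. of_nat (M choose l) * y j ^ l * (\<Sum>i\<in>I. y i) ^ (M - l)) / fact M"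
    unfolding sum_divide_distrib by (intro sum.cong) (auto simp: binomial_fact field_simps)
  also have "\<dots> = (\<Sum>i\<in>insert j I. y i) ^ M / fact M"
    using insert.hyps by (simp flip: binomial_ring)
  finally show ?case .
qed

text \<open>
  The left-hand side is the coefficient of \<open>s\<^sup>M\<close> in a product of power series with nonnegative
  coefficients.
\<close>

lemma sum_compositions_le:
  fixes f :: "'i \<Rightarrow> nat \<Rightarrow> real"
  assumes "finite I" "\<And>i l. i \<in> I \<Longrightarrow> 0 \<le> f i l" "0 < s"
  shows "(\<Sum>a\<in>compositions I M. \<Prod>i\<in>I. f i (a i)) \<le> (\<Prod>i\<in>I. \<Sum>l\<le>M. f i l * s ^ l) / s ^ M"
proof -
  have "(\<Sum>a\<in>compositions I M. \<Prod>i\<in>I. f i (a i)) * s ^ M =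
     (\<Sum>a\<in>compositions I M. \<Prod>i\<in>I. f i (a i) * s ^ a i)"
    unfolding sum_distrib_right
  proof (intro sum.cong refl)
    fix a assume "a \<in> compositions I M"
    then have "M = (\<Sum>i\<in>I. a i)" by (simp add: compositions_def)
    then show "(\<Prod>i\<in>I. f i (a i)) * s ^ M = (\<Prod>i\<in>I. f i (a i) * s ^ a i)"
      by (simp add: prod.distrib power_sum)
  qed
  also have "\<dots> \<le> (\<Sum>a\<in>I \<rightarrow>\<^sub>E {..M}. \<Prod>i\<in>I. f i (a i) * s ^ a i)"
    by (intro sum_mono2 compositions_subset_PiE finite_PiE prod_nonneg) (use assms in auto)
  also have "\<dots> = (\<Prod>i\<in>I. \<Sum>l\<le>M. f i l * s ^ l)"
    using assms by (subst prod_sum_PiE) auto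
  finally show ?thesis using assms by (simp add: field_simps)
qed

section \<open>Counting sets of size k that contain a given set\<close>

text \<open>With denominators cleared: the quotient of the two binomials is the product of (k - i) /
  (d - i) over i < r, and each factor is at most k / d because k <= d.\<close>

lemma binomial_shift_le:
  assumes "r \<le> k" "k \<le> d"
  shows "((d - r) choose (k - r)) * d ^ r \<le> k ^ r * (d choose k)"
  using assms(1)
proof (induction r)
  case (Suc r)
  have dr: "d - r = Suc (d - Suc r)" "k - r = Suc (k - Suc r)" using Suc.prems assms by auto
  have abs: "(k - r) * ((d - r) choose (k - r)) = (d - r) * ((d - Suc r) choose (k - Suc r))"
    unfolding dr by (subst binomial_absorption) simp
  have le: "(k - r) * d \<le> k * (d - r)"
    unfolding diff_mult_distrib diff_mult_distrib2
    using mult_le_mono1[OF assms(2), of r] by (simp only: mult.commute[of r] diff_le_mono2)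
  have "(d - r) * (((d - Suc r) choose (k - Suc r)) * d ^ Suc r) =
     ((k - r) * d) * (((d - r) choose (k - r)) * d ^ r)"
    using arg_cong[OF abs[symmetric], of "\<lambda>t. t * d ^ Suc r"] by (simp add: mult_ac)
  also have "\<dots> \<le> (k * (d - r)) * (k ^ r * (d choose k))"
    using mult_le_mono[OF le Suc.IH] Suc.prems by simp
  also have "\<dots> = (d - r) * (k ^ Suc r * (d choose k))" by (simp add: mult_ac)
  finally show ?case using dr(1) by (simp only: mult_le_cancel1)
qed simp

lemma card_supersets:
  assumes "finite D" "J \<subseteq> D" "card J \<le> k"
  shows "card {T. T \<subseteq> D \<and> card T = k \<and> J \<subseteq> T} = (card D - card J) choose (k - card J)"
proof -
  have fin: "finite J" "finite (D - J)" using assms finite_subset by auto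
  have "bij_betw (\<lambda>T. T - J) {T. T \<subseteq> D \<and> card T = k \<and> J \<subseteq> T} {T. T \<subseteq> D - J \<and> card T = k - card J}"
  proof (rule bij_betwI[where g = "\<lambda>T. T \<union> J"])
    show "(\<lambda>T. T \<union> J) \<in> {T. T \<subseteq> D - J \<and> card T = k - card J} \<rightarrow> {T. T \<subseteq> D \<and> card T = k \<and> J \<subseteq> T}"
    proof safe
      fix T assume "T \<subseteq> D - J" "card T = k - card J"
      then show "card (T \<union> J) = k"
        using assms fin by (subst card_Un_disjoint) (auto intro: finite_subset)
    qed (use assms in auto)
  qed (use fin in \<open>auto simp: card_Diff_subset\<close>)
  then have "card {T. T \<subseteq> D \<and> card T = k \<and> J \<subseteq> T} = card {T. T \<subseteq> D - J \<and> card T = k - card J}"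
    by (rule bij_betw_same_card)
  also have "\<dots> = card (D - J) choose (k - card J)" using fin by (intro n_subsets)
  also have "card (D - J) = card D - card J" using fin assms by (simp add: card_Diff_subset)
  finally show ?thesis .
qed

section \<open>Moments of the spike prior\<close>

text \<open>A spike amounts to its support T among the random coordinates and the subset U of T
  where the sign is positive; this leaves 2^k sign patterns per support.\<close>

lemma card_spikes_superset:
  assumes "J \<subseteq> {1..d}"
  shows "card {x \<in> spikes d k. \<forall>j\<in>J. x $ j \<noteq> 0} = card {T. T \<subseteq> {1..d} \<and> card T = k \<and> J \<subseteq> T} * 2 ^ k"
    (is "card ?X = card ?T * _")
proof -
  define s where "s = 1 / sqrt (real (k + 1))"
  have s: "s > 0" by (simp add: s_def)
  have spk: "spikes d k = {x \<in> carrier_vec (d + 1). x $ 0 = - s \<and>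
     (\<forall>i\<in>{1..d}. x $ i \<in> {s, - s, 0}) \<and> card {i \<in> {1..d}. x $ i \<noteq> 0} = k}"
    by (simp add: spikes_def s_def)
  define \<phi> where "\<phi> = (\<lambda>(T, U). vec (d + 1) (\<lambda>j. if j = 0 then - s else if j \<in> U then s
     else if j \<in> T then - s else (0 :: real)))"
  define \<psi> where "\<psi> x = ({j \<in> {1..d}. x $ j \<noteq> 0}, {j \<in> {1..d}. x $ j = s})" for x :: "real vec"
  have "bij_betw \<phi> (SIGMA T:?T. Pow T) ?X"
  proof (rule bij_betwI[where g = \<psi>])
    show "\<phi> \<in> (SIGMA T:?T. Pow T) \<rightarrow> ?X"
    proof
      fix p assume "p \<in> (SIGMA T:?T. Pow T)"
      then obtain T U where p: "p = (T, U)" "U \<subseteq> T" "T \<subseteq> {1..d}" "card T = k" "J \<subseteq> T" by auto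
      have nz: "\<phi> p $ j \<noteq> 0 \<longleftrightarrow> j \<in> T" if "j \<in> {1..d}" for j
        using that p s by (auto simp: \<phi>_def)
      then have "{i \<in> {1..d}. \<phi> p $ i \<noteq> 0} = T" using p(3) by blast
      moreover have "\<forall>j\<in>J. \<phi> p $ j \<noteq> 0" using nz p(3,5) by blast
      moreover have "\<forall>i\<in>{1..d}. \<phi> p $ i \<in> {s, - s, 0}" using p by (auto simp: \<phi>_def)
      moreover have "\<phi> p $ 0 = - s" "\<phi> p \<in> carrier_vec (d + 1)" using p(1) by (simp_all add: \<phi>_def)
      ultimately show "\<phi> p \<in> ?X" unfolding spk using p(4) by blast
    qed
    show "\<psi> \<in> ?X \<rightarrow> (SIGMA T:?T. Pow T)"
    proof
      fix x assume x: "x \<in> ?X"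
      then have "J \<subseteq> {j \<in> {1..d}. x $ j \<noteq> 0}" using assms by blast
      moreover have "{j \<in> {1..d}. x $ j = s} \<subseteq> {j \<in> {1..d}. x $ j \<noteq> 0}" using s by auto
      moreover have "card {j \<in> {1..d}. x $ j \<noteq> 0} = k" using x unfolding spk by blast
      ultimately show "\<psi> x \<in> (SIGMA T:?T. Pow T)" unfolding \<psi>_def by blast
    qed
    show "\<psi> (\<phi> p) = p" if "p \<in> (SIGMA T:?T. Pow T)" for p
    proof -
      from that obtain T U where p: "p = (T, U)" "U \<subseteq> T" "T \<subseteq> {1..d}" by auto
      then have \<phi>p: "\<phi> p $ j = (if j \<in> U then s else if j \<in> T then - s else 0)" if "j \<in> {1..d}" for j
        using that by (simp add: \<phi>_def)
      have "{j \<in> {1..d}. \<phi> p $ j \<noteq> 0} = {j \<in> {1..d}. j \<in> T}"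
        using \<phi>p p(2) s by (intro Collect_cong conj_cong refl) auto
      moreover have "{j \<in> {1..d}. \<phi> p $ j = s} = {j \<in> {1..d}. j \<in> U}"
        using \<phi>p p(2) s by (intro Collect_cong conj_cong refl) auto
      ultimately show ?thesis unfolding \<psi>_def using p by blast
    qed
    show "\<phi> (\<psi> x) = x" if "x \<in> ?X" for x
    proof (rule eq_vecI)
      have xs: "x \<in> carrier_vec (d + 1)" "x $ 0 = - s" "\<forall>i\<in>{1..d}. x $ i \<in> {s, - s, 0}"
        using that unfolding spk by blast+
      show "dim_vec (\<phi> (\<psi> x)) = dim_vec x" using xs(1) by (simp add: \<phi>_def \<psi>_def)
      fix j assume "j < dim_vec x"
      then have j: "j < d + 1" using xs(1) by simp
      show "\<phi> (\<psi> x) $ j = x $ j"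
      proof (cases "j = 0")
        case False
        then have "j \<in> {1..d}" using j by auto
        then have "x $ j \<in> {s, - s, 0}" using xs(3) by blast
        then show ?thesis using \<open>j \<in> {1..d}\<close> s by (auto simp: \<phi>_def \<psi>_def)
      qed (use xs(2) in \<open>simp add: \<phi>_def\<close>, simp add: \<psi>_def)
    qed
  qed
  then have "card ?X = card (SIGMA T:?T. Pow T)" by (rule bij_betw_same_card[symmetric])
  also have "\<dots> = (\<Sum>T\<in>?T. card (Pow T))"
  proof (rule card_SigmaI)
    show "finite ?T" by (rule finite_subset[of _ "Pow {1..d}"]) auto
    show "\<forall>T\<in>?T. finite (Pow T)" by (auto intro: finite_subset)
  qed
  also have "\<dots> = card ?T * 2 ^ k"
    by (simp add: card_Pow finite_subset[of _ "{1..d}"])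
  finally show ?thesis .
qed

lemma card_spikes: "card (spikes d k) = (d choose k) * 2 ^ k"
  using card_spikes_superset[of "{}" d k] card_supersets[of "{1..d}" "{}" k] by simp

lemma card_spikes_pos: "k \<le> d \<Longrightarrow> 0 < card (spikes d k)"
  by (simp add: card_spikes)

text \<open>Drawing a support without replacement covers \<open>J\<close> with probability at most
  that of independent draws, (k / d)^|J|; more than k coordinates are never covered.\<close>

lemma spike_support_probability:
  assumes "J \<subseteq> {1..d}" "k \<le> d"
  shows "real (card {x \<in> spikes d k. \<forall>j\<in>J. x $ j \<noteq> 0}) \<le> (real k / real d) ^ card J * real (card (spikes d k))"
proof (cases "card J \<le> k")
  case False
  have e: "{T. T \<subseteq> {1..d} \<and> card T = k \<and> J \<subseteq> T} = {}"
  proof (safe, rule ccontr)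
    fix T assume "T \<subseteq> {1..d}" "J \<subseteq> T" "k = card T"
    then show False using False card_mono[of T J] finite_subset[of T "{1..d}"] by simp
  qed
  show ?thesis unfolding card_spikes_superset[OF assms(1)] e by simp
next
  case True
  show ?thesis
  proof (cases "d = 0")
    \<comment> \<open>Here k = 0 and \<open>J\<close> is empty; the quotient k / d is 0 by
      convention, but its power is 0^0 = 1.\<close>
    case True then show ?thesis using assms by simp
  next
    case False
    have "real (((d - card J) choose (k - card J)) * d ^ card J) \<le> real (k ^ card J * (d choose k))"
      using binomial_shift_le[OF True assms(2)] by (simp only: of_nat_le_iff)
    then have "real ((d - card J) choose (k - card J)) \<le> (real k / real d) ^ card J * real (d choose k)"
      using False by (simp add: field_simps)
    then show ?thesis using True assms
      by (simp add: card_spikes card_spikes_superset card_supersets)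
  qed
qed

definition spike_moment :: "nat \<Rightarrow> nat \<Rightarrow> (nat \<Rightarrow> nat) \<Rightarrow> real" where
  "spike_moment d k a = (\<Sum>x\<in>spikes d k. \<Prod>j<d + 1. (x $ j) ^ a j) / card (spikes d k)"

text \<open>Flipping the sign of coordinate \<open>j\<close> is an involution of the spikes that
  negates the monomial. Coordinate 0 is excluded since its sign is fixed.\<close>

lemma spike_moment_odd:
  assumes j: "j \<in> {1..d}" "odd (a j)"
  shows "spike_moment d k a = 0"
proof -
  define F where "F x = vec (d + 1) (\<lambda>i. if i = j then - (x $ i) else x $ i)" for x :: "real vec"
  have F: "F x \<in> spikes d k" if "x \<in> spikes d k" for x
  proof -
    have "{i \<in> {1..d}. F x $ i \<noteq> 0} = {i \<in> {1..d}. x $ i \<noteq> 0}"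
      by (auto simp: F_def split: if_splits)
    moreover have "F x $ i \<in> {1 / sqrt (real (k + 1)), - 1 / sqrt (real (k + 1)), 0}" if i: "i \<in> {1..d}" for i
    proof -
      have "x $ i \<in> {1 / sqrt (real (k + 1)), - 1 / sqrt (real (k + 1)), 0}"
        using \<open>x \<in> spikes d k\<close> i unfolding spikes_def by blast
      then show ?thesis using i by (auto simp: F_def)
    qed
    moreover have "F x $ 0 = x $ 0" using j by (simp add: F_def)
    ultimately show ?thesis using that unfolding spikes_def by (auto simp: F_def)
  qed
  have FF: "F (F x) = x" if "x \<in> spikes d k" for x
    by (rule eq_vecI) (use that in \<open>auto simp: F_def spikes_def\<close>)
  have neg: "(\<Prod>i<d + 1. (F x $ i) ^ a i) = - (\<Prod>i<d + 1. (x $ i) ^ a i)" for x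
  proof -
    have "(\<Prod>i<d + 1. (F x $ i) ^ a i) = (\<Prod>i<d + 1. (if i = j then -1 else 1) * (x $ i) ^ a i)"
      using j by (intro prod.cong) (auto simp: F_def)
    also have "\<dots> = (\<Prod>i<d + 1. (if i = j then -1 else 1)) * (\<Prod>i<d + 1. (x $ i) ^ a i)"
      by (rule prod.distrib)
    also have "(\<Prod>i<d + 1. (if i = j then -1 else 1 :: real)) = -1"
      using j by (subst prod.delta) auto
    finally show ?thesis by simp
  qed
  have "(\<Sum>x\<in>spikes d k. \<Prod>i<d + 1. (x $ i) ^ a i) = (\<Sum>x\<in>spikes d k. \<Prod>i<d + 1. (F x $ i) ^ a i)"
    by (rule sum.reindex_bij_witness[where i = F and j = F]) (auto simp: F FF)
  also have "\<dots> = - (\<Sum>x\<in>spikes d k. \<Prod>i<d + 1. (x $ i) ^ a i)"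
    unfolding neg by (rule sum_negf)
  finally show ?thesis by (simp add: spike_moment_def)
qed

text \<open>Entries are at most (k + 1)^(-1/2) in size, and the monomial vanishes unless the support
  covers every random coordinate with positive exponent. The bound is a product over coordinates so
  that a generating function in the exponents factorises; coordinate 0 contributes 1, being always
  present and having no parity.\<close>

lemma spike_moment_sq_le:
  assumes "k \<le> d" "a \<in> compositions {..<d + 1} M"
  shows "(spike_moment d k a)\<^sup>2 \<le> (1 / real (k + 1)) ^ M *
     (\<Prod>j<d + 1. if j = 0 \<or> a j = 0 then 1 else if odd (a j) then 0 else (real k / real d)\<^sup>2)"
proof (cases "\<exists>j\<in>{1..d}. odd (a j)")
  case True
  then show ?thesis using spike_moment_odd by (auto intro!: prod_nonneg mult_nonneg_nonneg)
next
  case False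
  define J where "J = {j \<in> {1..d}. a j \<noteq> 0}"
  define s where "s = 1 / sqrt (real (k + 1))"
  have s: "s > 0" "s\<^sup>2 = 1 / real (k + 1)" by (simp_all add: s_def power_divide)
  have J: "J \<subseteq> {1..d}" "finite J" by (auto simp: J_def)
  let ?N = "real (card (spikes d k))"
  have N: "?N > 0" using card_spikes_pos[OF assms(1)] by simp
  have fin: "finite (spikes d k)" using card_spikes_pos[OF assms(1)] by (rule card_ge_0_finite)
  have bd: "\<bar>\<Prod>j<d + 1. (x $ j) ^ a j\<bar> \<le> (if \<forall>j\<in>J. x $ j \<noteq> 0 then s ^ M else 0)"
    if x: "x \<in> spikes d k" for x
  proof (cases "\<forall>j\<in>J. x $ j \<noteq> 0")
    case True
    have "\<bar>x $ j\<bar> \<le> s" if "j < d + 1" for j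
    proof (cases "j = 0")
      case True then show ?thesis using x by (simp add: spikes_def s_def)
    next
      case False
      then have "x $ j \<in> {1 / sqrt (real (k + 1)), - 1 / sqrt (real (k + 1)), 0}"
        using x that unfolding spikes_def by auto
      then show ?thesis by (auto simp: s_def)
    qed
    then have "\<bar>\<Prod>j<d + 1. (x $ j) ^ a j\<bar> \<le> (\<Prod>j<d + 1. s ^ a j)"
      unfolding abs_prod by (intro prod_mono) (auto simp: power_abs intro!: power_mono)
    also have "\<dots> = s ^ M" using assms(2) by (simp only: compositions_def power_sum mem_Collect_eq)
       (simp only: power_sum[symmetric])
    finally show ?thesis using True by simp
  next
    case False
    then obtain j where "j \<in> J" "x $ j = 0" by blast
    then have "(\<Prod>j<d + 1. (x $ j) ^ a j) = 0"
      by (intro prod_zero) (auto simp: J_def intro!: bexI[of _ j])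
    with False show ?thesis by auto
  qed
  have "\<bar>spike_moment d k a\<bar> \<le> (\<Sum>x\<in>spikes d k. if \<forall>j\<in>J. x $ j \<noteq> 0 then s ^ M else 0) / ?N"
    unfolding spike_moment_def abs_divide
    by (intro frac_le order_trans[OF sum_abs] sum_mono bd sum_nonneg) (use N s in auto)
  also have "(\<Sum>x\<in>spikes d k. if \<forall>j\<in>J. x $ j \<noteq> 0 then s ^ M else 0) =
     s ^ M * real (card {x \<in> spikes d k. \<forall>j\<in>J. x $ j \<noteq> 0})"
    using fin by (simp add: sum.If_cases Int_def conj_commute)
  also have "\<dots> / ?N \<le> s ^ M * ((real k / real d) ^ card J * ?N) / ?N"
    using s N spike_support_probability[OF J(1) assms(1)] by (intro divide_right_mono mult_left_mono) auto
  finally have "\<bar>spike_moment d k a\<bar> \<le> s ^ M * (real k / real d) ^ card J" using N by simp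
  then have "\<bar>spike_moment d k a\<bar>\<^sup>2 \<le> (s ^ M * (real k / real d) ^ card J)\<^sup>2"
    by (rule power_mono) simp
  also have "\<dots> = (s\<^sup>2) ^ M * ((real k / real d)\<^sup>2) ^ card J"
    by (simp add: power_mult_distrib flip: power_mult) (simp add: mult.commute)
  also have "((real k / real d)\<^sup>2) ^ card J =
     (\<Prod>j<d + 1. if j \<in> J then (real k / real d)\<^sup>2 else 1)"
  proof -
    have "{..<d + 1} \<inter> J = J" using J by auto
    then show ?thesis by (simp only: prod.If_cases[OF finite_lessThan] Collect_mem_eq) simp
  qed
  also have "\<dots> = (\<Prod>j<d + 1. if j = 0 \<or> a j = 0 then 1 else if odd (a j) then 0 else (real k / real d)\<^sup>2)"
    using False by (intro prod.cong) (auto simp: J_def)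
  finally show ?thesis by (simp add: s(2))
qed

section \<open>The low-degree likelihood norm\<close>

text \<open>Exponent matrices of total degree M, with samples as rows and coordinates as
  columns.\<close>

definition nested_compositions :: "'i set \<Rightarrow> 'j set \<Rightarrow> nat \<Rightarrow> ('i \<Rightarrow> 'j \<Rightarrow> nat) set" where
  "nested_compositions I J M = {\<beta> \<in> I \<rightarrow>\<^sub>E (J \<rightarrow>\<^sub>E UNIV). (\<Sum>i\<in>I. \<Sum>j\<in>J. \<beta> i j) = M}"

lemma nested_compositions_eq:
  assumes "finite I"
  shows "nested_compositions I J M = (\<Union>m\<in>compositions I M. PiE I (\<lambda>i. compositions J (m i)))"
proof (intro equalityI subsetI)
  fix \<beta> assume b: "\<beta> \<in> nested_compositions I J M"
  define m where "m = restrict (\<lambda>i. \<Sum>j\<in>J. \<beta> i j) I"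
  have "m \<in> compositions I M" "\<beta> \<in> PiE I (\<lambda>i. compositions J (m i))"
    using b by (auto simp: nested_compositions_def compositions_def m_def PiE_iff)
  then show "\<beta> \<in> (\<Union>m\<in>compositions I M. PiE I (\<lambda>i. compositions J (m i)))" by blast
qed (auto simp: nested_compositions_def compositions_def PiE_iff cong: sum.cong)

lemma finite_nested_compositions:
  "finite I \<Longrightarrow> finite J \<Longrightarrow> finite (nested_compositions I J M)"
  by (simp add: nested_compositions_eq finite_compositions finite_PiE)

text \<open>Group the matrices by their row sums \<open>m\<close>; once these are fixed, the rows
  range independently.\<close>

lemma sum_nested_compositions:
  fixes g :: "('j \<Rightarrow> nat) \<Rightarrow> real"
  assumes "finite I" "finite J"
  shows "(\<Sum>\<beta>\<in>nested_compositions I J M. \<Prod>i\<in>I. g (\<beta> i)) =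
    (\<Sum>m\<in>compositions I M. \<Prod>i\<in>I. \<Sum>b\<in>compositions J (m i). g b)"
proof -
  have disj: "PiE I (\<lambda>i. compositions J (m i)) \<inter> PiE I (\<lambda>i. compositions J (m' i)) = {}"
    if "m \<in> compositions I M" "m' \<in> compositions I M" "m \<noteq> m'" for m m'
  proof -
    have "\<exists>i\<in>I. m i \<noteq> m' i"
    proof (rule ccontr)
      assume "\<not> ?thesis"
      then have "m = m'" using that(1,2) unfolding compositions_def by (blast intro: PiE_ext)
      with that(3) show False by blast
    qed
    then obtain i where "i \<in> I" "m i \<noteq> m' i" by blast
    then show ?thesis by (auto simp: PiE_iff compositions_def)
  qed
  show ?thesis unfolding nested_compositions_eq[OF assms(1)]
    using assms disj by (subst sum.UNION_disjoint)
      (auto simp: finite_compositions finite_PiE prod_sum_PiE intro!: sum.cong)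
qed

text \<open>The planted mean of a Hermite product. The average over spikes stands outside the
  product over samples because all samples share the spike.\<close>

definition planted_coeff :: "nat \<Rightarrow> nat \<Rightarrow> real \<Rightarrow> nat \<Rightarrow> (nat \<Rightarrow> nat \<Rightarrow> nat) \<Rightarrow> real" where
  "planted_coeff d k \<theta> n \<beta> = (\<Sum>x\<in>spikes d k. \<Prod>i<n. spiked_coeff \<theta> (\<Sum>j<d + 1. \<beta> i j) *
     (\<Prod>j<d + 1. (x $ j) ^ \<beta> i j)) / card (spikes d k)"

text \<open>The factor K (n, M) of the overview: the coefficient of t^M in the n-th power of the
  series with coefficients w(l)^2 / l!.\<close>

definition row_weight :: "real \<Rightarrow> nat \<Rightarrow> nat \<Rightarrow> real" where
  "row_weight \<theta> n M = (\<Sum>m\<in>compositions {..<n} M. \<Prod>i<n. (spiked_coeff \<theta> (m i))\<^sup>2 / fact (m i))"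

text \<open>The moment E <x, x'>^M, expanded by the multinomial theorem; independence turns the mean
  of each term into a squared moment of one spike.\<close>

definition overlap_moment :: "nat \<Rightarrow> nat \<Rightarrow> nat \<Rightarrow> real" where
  "overlap_moment d k M =
     fact M * (\<Sum>a\<in>compositions {..<d + 1} M. (spike_moment d k a)\<^sup>2 / (\<Prod>j<d + 1. fact (a j)))"

text \<open>Write each square as a double average over spikes x, x'. Row i, summed over its exponent
  vectors of degree m_i, gives w(m_i)^2 / m_i! times <x, x'>^(m_i); over all rows the overlap
  becomes <x, x'>^M, which no longer depends on \<open>m\<close>.\<close>

lemma sum_planted_coeff_sq:
  "(\<Sum>\<beta>\<in>nested_compositions {..<n} {..<d + 1} M.
      (planted_coeff d k \<theta> n \<beta>)\<^sup>2 / (\<Prod>i<n. \<Prod>j<d + 1. fact (\<beta> i j))) =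
    row_weight \<theta> n M * overlap_moment d k M"
proof -
  define J where "J = {..<d + 1}"
  define S where "S = spikes d k"
  define N where "N = real (card S)"
  define B where "B = nested_compositions {..<n} J M"
  define w where "w b = spiked_coeff \<theta> (\<Sum>j\<in>J. b j)" for b :: "nat \<Rightarrow> nat"
  define y where "y x x' j = x $ j * x' $ j" for x x' :: "real vec" and j
  define g where "g x x' b = (w b)\<^sup>2 * (\<Prod>j\<in>J. y x x' j ^ b j / fact (b j))"
    for x x' :: "real vec" and b
  have fJ: "finite J" by (simp add: J_def)
  have 1: "(planted_coeff d k \<theta> n \<beta>)\<^sup>2 / (\<Prod>i<n. \<Prod>j\<in>J. fact (\<beta> i j)) =
      (\<Sum>x\<in>S. \<Sum>x'\<in>S. \<Prod>i<n. g x x' (\<beta> i)) / N\<^sup>2" for \<beta>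
  proof -
    define p where "p x = (\<Prod>i<n. w (\<beta> i) * (\<Prod>j\<in>J. (x $ j) ^ \<beta> i j))" for x :: "real vec"
    define c where "c = (\<Prod>i<n. \<Prod>j\<in>J. fact (\<beta> i j) :: real)"
    have pp: "p x * p x' / c = (\<Prod>i<n. g x x' (\<beta> i))" for x x'
      by (simp add: p_def c_def g_def y_def prod.distrib power_mult_distrib power2_eq_square mult_ac
          prod_dividef)
    have "(planted_coeff d k \<theta> n \<beta>)\<^sup>2 / c = ((\<Sum>x\<in>S. p x) / N)\<^sup>2 / c"
      by (simp only: planted_coeff_def S_def[symmetric] N_def w_def J_def[symmetric] p_def)
    also have "\<dots> = (\<Sum>x\<in>S. \<Sum>x'\<in>S. p x * p x') / c / N\<^sup>2"
      by (simp add: power_divide sum_product[symmetric] power2_eq_square mult_ac)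
    also have "(\<Sum>x\<in>S. \<Sum>x'\<in>S. p x * p x') / c = (\<Sum>x\<in>S. \<Sum>x'\<in>S. \<Prod>i<n. g x x' (\<beta> i))"
      by (simp only: sum_divide_distrib pp)
    finally show ?thesis unfolding c_def .
  qed
  have 2: "(\<Sum>\<beta>\<in>B. \<Prod>i<n. g x x' (\<beta> i)) = row_weight \<theta> n M * (\<Sum>j\<in>J. y x x' j) ^ M" for x x'
  proof -
    have "(\<Sum>\<beta>\<in>B. \<Prod>i<n. g x x' (\<beta> i)) =
      (\<Sum>m\<in>compositions {..<n} M. \<Prod>i<n. \<Sum>b\<in>compositions J (m i). g x x' b)"
      unfolding B_def by (rule sum_nested_compositions) (auto simp: J_def)
    also have "\<dots> = (\<Sum>m\<in>compositions {..<n} M. (\<Prod>i<n. (spiked_coeff \<theta> (m i))\<^sup>2 / fact (m i)) *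
        (\<Sum>j\<in>J. y x x' j) ^ M)"
    proof (intro sum.cong refl)
      fix m assume m: "m \<in> compositions {..<n} M"
      have "(\<Sum>b\<in>compositions J (m i). g x x' b) =
          (spiked_coeff \<theta> (m i))\<^sup>2 / fact (m i) * (\<Sum>j\<in>J. y x x' j) ^ m i" for i
      proof -
        have "(\<Sum>b\<in>compositions J (m i). g x x' b) =
          (\<Sum>b\<in>compositions J (m i). (spiked_coeff \<theta> (m i))\<^sup>2 * (\<Prod>j\<in>J. y x x' j ^ b j / fact (b j)))"
          by (intro sum.cong) (auto simp: g_def w_def compositions_def)
        also have "\<dots> = (spiked_coeff \<theta> (m i))\<^sup>2 * ((\<Sum>j\<in>J. y x x' j) ^ m i / fact (m i))"
          by (simp add: multinomial_compositions[OF fJ] flip: sum_distrib_left)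
        finally show ?thesis by simp
      qed
      then show "(\<Prod>i<n. \<Sum>b\<in>compositions J (m i). g x x' b) =
        (\<Prod>i<n. (spiked_coeff \<theta> (m i))\<^sup>2 / fact (m i)) * (\<Sum>j\<in>J. y x x' j) ^ M"
        using m by (simp only: prod.distrib power_sum[symmetric] compositions_def mem_Collect_eq)
    qed
    finally show ?thesis by (simp only: row_weight_def sum_distrib_right)
  qed
  \<comment> \<open>Expand the overlap again and average inside: this returns squared spike moments,
    to which the parity and support bounds apply.\<close>
  have 3: "(\<Sum>x\<in>S. \<Sum>x'\<in>S. (\<Sum>j\<in>J. y x x' j) ^ M) / N\<^sup>2 = overlap_moment d k M"
  proof -
    have "(\<Sum>j\<in>J. y x x' j) ^ M = fact M * (\<Sum>a\<in>compositions J M.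
        (\<Prod>j\<in>J. (x $ j) ^ a j) * (\<Prod>j\<in>J. (x' $ j) ^ a j) / (\<Prod>j\<in>J. fact (a j)))" for x x'
      using multinomial_compositions[OF fJ, of "y x x'" M]
      by (simp add: y_def power_mult_distrib prod_dividef prod.distrib)
    then have "(\<Sum>x\<in>S. \<Sum>x'\<in>S. (\<Sum>j\<in>J. y x x' j) ^ M) = (\<Sum>x\<in>S. \<Sum>x'\<in>S. fact M * (\<Sum>a\<in>compositions J M.
        (\<Prod>j\<in>J. (x $ j) ^ a j) * (\<Prod>j\<in>J. (x' $ j) ^ a j) / (\<Prod>j\<in>J. fact (a j))))" by simp
    also have "\<dots> = fact M * (\<Sum>x\<in>S. \<Sum>x'\<in>S. \<Sum>a\<in>compositions J M.
        (\<Prod>j\<in>J. (x $ j) ^ a j) * (\<Prod>j\<in>J. (x' $ j) ^ a j) / (\<Prod>j\<in>J. fact (a j)))"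
      by (simp only: sum_distrib_left)
    also have "(\<Sum>x\<in>S. \<Sum>x'\<in>S. \<Sum>a\<in>compositions J M.
        (\<Prod>j\<in>J. (x $ j) ^ a j) * (\<Prod>j\<in>J. (x' $ j) ^ a j) / (\<Prod>j\<in>J. fact (a j))) =
       (\<Sum>a\<in>compositions J M. \<Sum>x\<in>S. \<Sum>x'\<in>S.
        (\<Prod>j\<in>J. (x $ j) ^ a j) * (\<Prod>j\<in>J. (x' $ j) ^ a j) / (\<Prod>j\<in>J. fact (a j)))"
      by (subst sum.swap[of _ "compositions J M" S, symmetric])
         (simp only: sum.swap[of _ "compositions J M" S])
    also have "\<dots> = (\<Sum>a\<in>compositions J M. (\<Sum>x\<in>S. \<Prod>j\<in>J. (x $ j) ^ a j)\<^sup>2 / (\<Prod>j\<in>J. fact (a j)))"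
      by (simp only: power2_eq_square sum_product sum_divide_distrib)
    finally have "(\<Sum>x\<in>S. \<Sum>x'\<in>S. (\<Sum>j\<in>J. y x x' j) ^ M) / N\<^sup>2 =
        fact M * (\<Sum>a\<in>compositions J M. (\<Sum>x\<in>S. \<Prod>j\<in>J. (x $ j) ^ a j)\<^sup>2 / (\<Prod>j\<in>J. fact (a j))) / N\<^sup>2"
      by (rule arg_cong)
    also have "fact M * (\<Sum>a\<in>C. (X a)\<^sup>2 / F a) / N\<^sup>2 = fact M * (\<Sum>a\<in>C. (X a / N)\<^sup>2 / F a)"
      for X F and C :: "(nat \<Rightarrow> nat) set"
      by (simp add: sum_distrib_left sum_divide_distrib power_divide mult_ac)
    finally show ?thesis
      unfolding overlap_moment_def spike_moment_def J_def[symmetric] S_def[symmetric] N_def[symmetric] .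
  qed
  have "(\<Sum>\<beta>\<in>B. (planted_coeff d k \<theta> n \<beta>)\<^sup>2 / (\<Prod>i<n. \<Prod>j\<in>J. fact (\<beta> i j))) =
     (\<Sum>x\<in>S. \<Sum>x'\<in>S. \<Sum>\<beta>\<in>B. \<Prod>i<n. g x x' (\<beta> i)) / N\<^sup>2"
    unfolding 1 sum_divide_distrib[symmetric]
    by (subst sum.swap, subst sum.swap[of _ B S]) (rule refl)
  also have "\<dots> = row_weight \<theta> n M * ((\<Sum>x\<in>S. \<Sum>x'\<in>S. (\<Sum>j\<in>J. y x x' j) ^ M) / N\<^sup>2)"
    by (simp only: 2 sum_distrib_left times_divide_eq_right)
  finally show ?thesis unfolding 3 unfolding B_def J_def .
qed

section \<open>Bounding both factors through their generating functions\<close>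

lemma sum_even_powers_le:
  fixes v :: real
  assumes "0 \<le> v" "v < 1"
  shows "(\<Sum>l\<le>M. (if even l then 1 else 0) * v ^ l) \<le> 1 / (1 - v\<^sup>2)"
proof -
  have "(\<Sum>l\<le>2 * q + 1. (if even l then 1 else 0) * v ^ l) = (\<Sum>i\<le>q. (v\<^sup>2) ^ i)" for q
    by (induction q) (simp_all add: power_mult[symmetric] mult.commute)
  then have "(\<Sum>l\<le>M. (if even l then 1 else 0) * v ^ l) \<le> (\<Sum>i\<le>M. (v\<^sup>2) ^ i)"
    using assms sum_mono2[of "{..2 * M + 1}" "{..M}" "\<lambda>l. (if even l then 1 else 0) * v ^ l"] by auto
  also have "\<dots> \<le> suminf (\<lambda>i. (v\<^sup>2) ^ i)"
    using assms by (intro sum_le_suminf summable_geometric) (auto simp: power_less_one_iff abs_square_less_1)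
  also have "\<dots> = 1 / (1 - v\<^sup>2)"
    using assms by (intro suminf_geometric) (auto simp: abs_square_less_1)
  finally show ?thesis .
qed

text \<open>As w(l)^2 <= l! and only even l occur, each row contributes at most 1 / (1 - v^2) to the
  generating function at v.\<close>

lemma row_weight_le:
  assumes "0 \<le> \<theta>" "\<theta> \<le> 1" "n \<ge> 1" "M \<ge> 1"
  shows "row_weight \<theta> n M \<le> sqrt ((n + M) / M) ^ M * exp (real M)"
proof -
  \<comment> \<open>Chosen so that 1 / (1 - v^2) = 1 + M / n, whose n-th power is at most e^M for
    every n.\<close>
  define v where "v = sqrt (M / (n + M))"
  have v2: "v\<^sup>2 = M / (n + M)" by (simp add: v_def)
  have v: "0 < v" "v < 1" using assms by (auto simp: v_def)
  have geo: "1 / (1 - v\<^sup>2) = 1 + M / n"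
    unfolding v2 using assms by (simp add: field_simps)
  have "row_weight \<theta> n M \<le> (\<Prod>i<n. \<Sum>l\<le>M. (spiked_coeff \<theta> l)\<^sup>2 / fact l * v ^ l) / v ^ M"
    unfolding row_weight_def by (rule sum_compositions_le) (use v in auto)
  also have "\<dots> \<le> (\<Prod>i<n. 1 + M / n) / v ^ M"
  proof (intro divide_right_mono prod_mono conjI)
    fix i
    have "(\<Sum>l\<le>M. (spiked_coeff \<theta> l)\<^sup>2 / fact l * v ^ l) \<le>
        (\<Sum>l\<le>M. (if even l then 1 else 0) * v ^ l)"
    proof (intro sum_mono mult_right_mono)
      fix l
      show "(spiked_coeff \<theta> l)\<^sup>2 / fact l \<le> (if even l then 1 else 0)"
        using spiked_coeff_sq_le[OF assms(1,2), of l] by (auto simp: divide_le_eq)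
    qed (use v in auto)
    also have "\<dots> \<le> 1 + M / n" using sum_even_powers_le[of v M] v geo by simp
    finally show "(\<Sum>l\<le>M. (spiked_coeff \<theta> l)\<^sup>2 / fact l * v ^ l) \<le> 1 + M / n" .
  qed (use v in \<open>auto intro!: sum_nonneg\<close>)
  also have "\<dots> = (1 + M / n) ^ n * (1 / v) ^ M" by (simp add: power_divide)
  also have "\<dots> \<le> exp (M / n) ^ n * (1 / v) ^ M"
    using v by (intro mult_right_mono power_mono) auto
  also have "exp (M / n) ^ n = exp (real M)"
    using assms by (simp flip: exp_of_nat_mult)
  also have "1 / v = sqrt ((n + M) / M)"
    by (simp add: v_def real_sqrt_divide)
  finally show ?thesis by (simp add: mult.commute)
qed

lemma sum_inverse_fact_le: "(\<Sum>l\<le>M. if l \<le> 1 then 0 else 1 / fact l) \<le> (1 :: real)"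
proof -
  \<comment> \<open>With upper limit \<open>M + 1\<close> both terms l = 0 and l = 1 are present
    even for M = 0, so exactly 2 is subtracted from a partial sum of e <= 3.\<close>
  have "(\<Sum>l\<le>M. if l \<le> 1 then 0 else 1 / fact l) \<le> (\<Sum>l\<le>M + 1. if l \<le> 1 then 0 else 1 / fact l :: real)"
    by (intro sum_mono2) auto
  also have "\<dots> = (\<Sum>l\<le>M + 1. 1 / fact l - (if l = 0 then 1 else 0) - (if l = 1 then 1 else 0))"
    by (intro sum.cong) (auto simp: le_Suc_eq)
  also have "\<dots> = (\<Sum>l\<le>M + 1. 1 / fact l) - 2" by (simp add: sum_subtractf)
  also have "(\<Sum>l\<le>M + 1. 1 / fact l) \<le> exp (1 :: real)"
    using sum_le_suminf[OF summable_exp[of "1 :: real"], of "{..M + 1}"]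
    by (simp add: exp_def divide_inverse)
  finally show ?thesis using exp_le by simp
qed

text \<open>In the generating function at s <= 1, coordinate 0 contributes at most e. Any other
  coordinate contributes at most 1 + q s^2, since odd exponents vanish and the inverse factorials
  from 2 on sum to at most 1. Here d q = k^2 / d is the mean size of the intersection of two
  independent supports.\<close>

lemma overlap_moment_le:
  assumes "1 \<le> k" "k \<le> d" "M \<ge> 1"
  shows "overlap_moment d k M \<le>
     fact M * ((1 / real (k + 1)) ^ M * (sqrt ((real k ^ 2 / d + M) / M) ^ M * exp (1 + real M)))"
proof -
  define q where "q = (real k / real d)\<^sup>2"
  define \<mu> where "\<mu> = real k ^ 2 / d"
  \<comment> \<open>With this s the remaining factor exp(\<mu> s^2) is at most e^M whatever \<mu>
    is.\<close>
  define s where "s = sqrt (M / (\<mu> + M))"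
  define h where "h j l = (if j = 0 \<or> l = 0 then 1 else if odd l then 0 else q) / fact l" for j l :: nat
  have \<mu>: "\<mu> > 0" "\<mu> = d * q" using assms by (auto simp: \<mu>_def q_def power2_eq_square)
  have s2: "s\<^sup>2 = M / (\<mu> + M)" using \<mu> by (simp add: s_def)
  have s: "0 < s" "s \<le> 1" using assms \<mu> by (auto simp: s_def)
  have q: "q \<ge> 0" by (simp add: q_def)
  have "(\<Sum>a\<in>compositions {..<d + 1} M. (spike_moment d k a)\<^sup>2 / (\<Prod>j<d + 1. fact (a j))) \<le>
     (\<Sum>a\<in>compositions {..<d + 1} M. (1 / real (k + 1)) ^ M * (\<Prod>j<d + 1. h j (a j)))"
  proof (rule sum_mono)
    fix a assume "a \<in> compositions {..<d + 1} M"
    then have "(spike_moment d k a)\<^sup>2 / (\<Prod>j<d + 1. fact (a j)) \<le> (1 / real (k + 1)) ^ M *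
     (\<Prod>j<d + 1. if j = 0 \<or> a j = 0 then 1 else if odd (a j) then 0 else q) / (\<Prod>j<d + 1. fact (a j))"
      unfolding q_def by (intro divide_right_mono spike_moment_sq_le assms prod_nonneg) auto
    also have "\<dots> = (1 / real (k + 1)) ^ M * (\<Prod>j<d + 1. h j (a j))"
      unfolding h_def prod_dividef by simp
    finally show "(spike_moment d k a)\<^sup>2 / (\<Prod>j<d + 1. fact (a j)) \<le> \<dots>" .
  qed
  also have "\<dots> = (1 / real (k + 1)) ^ M * (\<Sum>a\<in>compositions {..<d + 1} M. \<Prod>j<d + 1. h j (a j))"
    by (rule sum_distrib_left[symmetric])
  also have "(\<Sum>a\<in>compositions {..<d + 1} M. \<Prod>j<d + 1. h j (a j)) \<le>
      (\<Prod>j<d + 1. \<Sum>l\<le>M. h j l * s ^ l) / s ^ M"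
    by (rule sum_compositions_le) (use s q in \<open>auto simp: h_def\<close>)
  also have "(\<Prod>j<d + 1. \<Sum>l\<le>M. h j l * s ^ l) \<le> (\<Prod>j<d + 1. if j = 0 then exp 1 else 1 + q * s\<^sup>2)"
  proof (intro prod_mono conjI)
    fix j
    show "0 \<le> (\<Sum>l\<le>M. h j l * s ^ l)" using s q by (auto simp: h_def intro!: sum_nonneg)
    show "(\<Sum>l\<le>M. h j l * s ^ l) \<le> (if j = 0 then exp 1 else 1 + q * s\<^sup>2)"
    proof (cases "j = 0")
      case True
      have "(\<Sum>l\<le>M. h j l * s ^ l) \<le> (\<Sum>l\<le>M. 1 / fact l)"
        using s True by (intro sum_mono) (auto simp: h_def divide_le_cancel power_le_one)
      also have "\<dots> \<le> exp 1"
        using sum_le_suminf[OF summable_exp[of "1 :: real"], of "{..M}"]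
        by (simp add: exp_def divide_inverse)
      finally show ?thesis using True by simp
    next
      case False
      have "(\<Sum>l\<le>M. h j l * s ^ l) \<le>
        (\<Sum>l\<le>M. (if l = 0 then 1 else 0) + q * s\<^sup>2 * (if l \<le> 1 then 0 else 1 / fact l))"
      proof (intro sum_mono)
        fix l :: nat
        consider "l = 0" | "odd l" | "l \<ge> 2" "even l" by (cases l; cases "l = 1") auto
        then show "h j l * s ^ l \<le> (if l = 0 then 1 else 0) + q * s\<^sup>2 * (if l \<le> 1 then 0 else 1 / fact l)"
        proof cases
          case 3
          have "s ^ l \<le> s\<^sup>2" using s 3 by (intro power_decreasing) auto
          then have "q / fact l * s ^ l \<le> q / fact l * s\<^sup>2" using q by (intro mult_left_mono) auto
          then show ?thesis using 3 False by (simp add: h_def)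
        qed (use False q s in \<open>auto simp: h_def\<close>)
      qed
      also have "\<dots> = 1 + q * s\<^sup>2 * (\<Sum>l\<le>M. if l \<le> 1 then 0 else 1 / fact l)"
        by (simp only: sum.distrib sum_distrib_left[symmetric]) simp
      also have "\<dots> \<le> 1 + q * s\<^sup>2 * 1"
        using q by (intro add_left_mono mult_left_mono sum_inverse_fact_le) auto
      finally show ?thesis using False by simp
    qed
  qed
  also have "(\<Prod>j<d + 1. if j = 0 then exp 1 else 1 + q * s\<^sup>2) = exp 1 * (1 + q * s\<^sup>2) ^ d"
    by (simp only: Suc_eq_plus1[symmetric] prod.lessThan_Suc_shift) simp
  also have "(1 + q * s\<^sup>2) ^ d \<le> exp (q * s\<^sup>2) ^ d"
    using q by (intro power_mono) auto
  also have "exp (q * s\<^sup>2) ^ d = exp (\<mu> * s\<^sup>2)" by (simp add: \<mu>(2) mult.assoc flip: exp_of_nat_mult)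
  also have "exp (\<mu> * s\<^sup>2) \<le> exp (real M)"
    unfolding s2 using \<mu>(1) assms by (simp add: field_simps)
  also have "exp 1 * exp (real M) / s ^ M = (1 / s) ^ M * exp (1 + real M)"
    by (simp add: power_divide exp_add)
  also have "1 / s = sqrt ((\<mu> + M) / M)" by (simp add: s_def real_sqrt_divide)
  finally show ?thesis
    unfolding overlap_moment_def \<mu>_def using s
    by (simp add: mult_left_mono divide_right_mono)
qed

text \<open>The exponentials multiply to e^(2 M + 1) <= e^(3 M) <= 27^M, as M >= 1, and M! <= M^M
  cancels the denominators M under the roots. The hypothesis bounds the root of the product by k /
  54, where 2916 = 54^2, which leaves 27 / 54 = 1 / 2 per degree.\<close>

lemma planted_coeff_level_le:
  assumes "0 \<le> \<theta>" "\<theta> \<le> 1" "n \<ge> 1" "M \<ge> 1" "1 \<le> k" "k \<le> d"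
    and small: "(real n + real M) * (real k ^ 2 / d + real M) \<le> real k ^ 2 / 2916"
  shows "row_weight \<theta> n M * overlap_moment d k M \<le> (1 / 2) ^ M"
proof -
  define \<mu> where "\<mu> = real k ^ 2 / d"
  define A where "A = sqrt ((real n + M) / M)"
  define B where "B = sqrt ((\<mu> + M) / M)"
  have AB: "A \<ge> 0" "B \<ge> 0" by (auto simp: A_def B_def \<mu>_def)
  have nn: "overlap_moment d k M \<ge> 0"
    by (auto simp: overlap_moment_def intro!: mult_nonneg_nonneg sum_nonneg divide_nonneg_nonneg prod_nonneg)
  have "A * B = sqrt ((real n + M) * (\<mu> + M)) / M"
    using assms by (simp add: A_def B_def real_sqrt_mult real_sqrt_divide)
  also have "\<dots> \<le> (k / 54) / M"
  proof (intro divide_right_mono real_le_lsqrt)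
    show "(real n + M) * (\<mu> + M) \<le> (real k / 54)\<^sup>2"
      using small by (simp add: \<mu>_def power2_eq_square)
  qed auto
  finally have AB_le: "A * B \<le> k / (54 * M)" by simp
  have e3: "exp 3 \<le> (27 :: real)"
    using power_mono[OF exp_le, of 3] by (simp flip: exp_of_nat_mult)
  have "row_weight \<theta> n M * overlap_moment d k M \<le> (A ^ M * exp (real M)) *
     (fact M * ((1 / real (k + 1)) ^ M * (B ^ M * exp (1 + real M))))"
    using row_weight_le[OF assms(1-4)] overlap_moment_le[of k d M] assms nn AB
    by (intro mult_mono) (auto simp: A_def B_def \<mu>_def)
  also have "\<dots> = fact M * (1 / real (k + 1)) ^ M * (A * B) ^ M * (exp (real M) * exp (1 + real M))"
    by (simp add: power_mult_distrib)
  also have "exp (real M) * exp (1 + real M) \<le> exp 3 ^ M"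
    using assms by (simp flip: exp_add exp_of_nat_mult)
  also have "exp (3 :: real) ^ M \<le> 27 ^ M" by (rule power_mono[OF e3]) simp
  also have "fact M \<le> real M ^ M" using fact_le_power[of M, where 'a = real] by simp
  also have "real M ^ M * (1 / real (k + 1)) ^ M * (A * B) ^ M * 27 ^ M = (M * (1 / real (k + 1)) * (A * B) * 27) ^ M"
    by (simp only: power_mult_distrib)
  also have "\<dots> \<le> (1 / 2) ^ M"
  proof (rule power_mono)
    have "M * (1 / real (k + 1)) * (A * B) * 27 \<le> M * (1 / real (k + 1)) * (k / (54 * M)) * 27"
      using AB_le by (intro mult_right_mono mult_left_mono) auto
    also have "\<dots> = (real k / real (k + 1)) / 2" using assms(4) by (simp add: divide_simps)
    also have "\<dots> \<le> 1 / 2" by simp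
    finally show "M * (1 / real (k + 1)) * (A * B) * 27 \<le> 1 / 2" .
  qed (use AB in auto)
  finally show ?thesis using AB by (simp add: mult_right_mono mult_left_mono)
qed

section \<open>Expansion of polynomials in Hermite products\<close>

text \<open>Nonnegative integrals pass through the mixture directly; a signed integrand is split
  into positive and negative parts, each integrable under every kernel.\<close>

lemma integral_bind_uniform_count_measure:
  fixes f :: "'b \<Rightarrow> real"
  assumes A: "finite A" "A \<noteq> {}"
    and K: "\<And>x. x \<in> A \<Longrightarrow> prob_space (K x)" "\<And>x. x \<in> A \<Longrightarrow> sets (K x) = sets N"
    and f: "\<And>x. x \<in> A \<Longrightarrow> integrable (K x) f"
  shows "integral\<^sup>L (Giry_Monad.bind (uniform_count_measure A) K) f =
    (\<Sum>x\<in>A. integral\<^sup>L (K x) f) / card A"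
proof -
  let ?U = "uniform_count_measure A"
  let ?B = "Giry_Monad.bind ?U K"
  have Kmeas: "K \<in> measurable ?U (subprob_algebra N)"
  proof -
    have "K \<in> measurable (count_space A) (subprob_algebra N)"
      using K by (auto simp: space_subprob_algebra prob_space_imp_subprob_space)
    then show ?thesis
      by (subst measurable_cong_sets[OF sets_uniform_count_measure_count_space refl])
  qed
  have sets_B: "sets ?B = sets N"
    using A K by (intro sets_bind) (auto simp: space_uniform_count_measure)
  have nonneg: "has_bochner_integral ?B g ((\<Sum>x\<in>A. integral\<^sup>L (K x) g) / card A)"
    if g: "\<And>x. x \<in> A \<Longrightarrow> integrable (K x) g" "\<And>y. 0 \<le> g y" for g :: "'b \<Rightarrow> real"
  proof -
    have gN: "g \<in> borel_measurable N"
    proof -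
      obtain x where "x \<in> A" using A by blast
      then have "g \<in> borel_measurable (K x)" using g by auto
      then show ?thesis using K(2)[OF \<open>x \<in> A\<close>] by (simp cong: measurable_cong_sets)
    qed
    have int: "(\<integral>\<^sup>+y. ennreal (g y) \<partial>K x) = ennreal (integral\<^sup>L (K x) g)" if "x \<in> A" for x
      using g that by (intro nn_integral_eq_integral) auto
    have nn: "0 \<le> integral\<^sup>L (K x) g" for x using g by (intro Bochner_Integration.integral_nonneg) auto
    have "(\<integral>\<^sup>+y. ennreal (g y) \<partial>?B) = (\<integral>\<^sup>+x. \<integral>\<^sup>+y. ennreal (g y) \<partial>K x \<partial>?U)"
      using gN Kmeas by (intro nn_integral_bind) auto
    also have "\<dots> = (\<Sum>x\<in>A. ennreal (1 / card A) * (\<integral>\<^sup>+y. ennreal (g y) \<partial>K x))"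
      unfolding uniform_count_measure_def using A by (simp add: nn_integral_point_measure_finite)
    also have "\<dots> = (\<Sum>x\<in>A. ennreal (1 / card A * integral\<^sup>L (K x) g))"
      by (intro sum.cong refl) (simp add: int flip: ennreal_mult')
    also have "\<dots> = ennreal ((\<Sum>x\<in>A. integral\<^sup>L (K x) g) / card A)"
      using nn by (subst sum_ennreal) (auto simp: sum_divide_distrib)
    finally have eq: "(\<integral>\<^sup>+y. ennreal (g y) \<partial>?B) = ennreal ((\<Sum>x\<in>A. integral\<^sup>L (K x) g) / card A)" .
    have "g \<in> borel_measurable ?B"
      using gN sets_B by (simp cong: measurable_cong_sets)
    then show ?thesis
      using eq g nn by (intro has_bochner_integral_nn_integral) (auto intro!: divide_nonneg_nonneg sum_nonneg)
  qed
  have "has_bochner_integral ?B (\<lambda>y. max 0 (f y) - max 0 (- f y))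
     ((\<Sum>x\<in>A. LINT y|K x. max 0 (f y)) / card A - (\<Sum>x\<in>A. LINT y|K x. max 0 (- f y)) / card A)"
    by (intro has_bochner_integral_diff nonneg) (use f in auto)
  moreover have "(\<lambda>y. max 0 (f y) - max 0 (- f y)) = f" by (auto simp: max_def)
  moreover have "(\<Sum>x\<in>A. LINT y|K x. max 0 (f y)) / card A - (\<Sum>x\<in>A. LINT y|K x. max 0 (- f y)) / card A =
     (\<Sum>x\<in>A. integral\<^sup>L (K x) f) / card A"
  proof -
    have "(LINT y|K x. max 0 (f y)) - (LINT y|K x. max 0 (- f y)) = integral\<^sup>L (K x) f" if "x \<in> A" for x
    proof -
      have "(LINT y|K x. max 0 (f y)) - (LINT y|K x. max 0 (- f y)) =
          (LINT y|K x. max 0 (f y) - max 0 (- f y))"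
        by (rule Bochner_Integration.integral_diff[symmetric]) (use f[OF that] in auto)
      then show ?thesis by (simp add: \<open>(\<lambda>y. max 0 (f y) - max 0 (- f y)) = f\<close>)
    qed
    then show ?thesis by (simp add: diff_divide_distrib[symmetric] sum_subtractf[symmetric])
  qed
  ultimately show ?thesis by (simp add: has_bochner_integral_integral_eq)
qed

definition sample_hermite :: "nat \<Rightarrow> nat \<Rightarrow> (nat \<Rightarrow> nat \<Rightarrow> nat) \<Rightarrow> (nat \<Rightarrow> nat \<Rightarrow> real) \<Rightarrow> real" where
  "sample_hermite n d \<beta> z = (\<Prod>i<n. \<Prod>j<d + 1. poly (hermite (\<beta> i j)) (z i j))"

lemma spikes_unit_norm:
  assumes "x \<in> spikes d k"
  shows "x \<in> carrier_vec (d + 1)" "(\<Sum>j<d + 1. (x $ j)\<^sup>2) = 1"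
proof -
  show "x \<in> carrier_vec (d + 1)" using assms by (simp add: spikes_def)
  have x0: "(x $ 0)\<^sup>2 = 1 / real (k + 1)" using assms by (simp add: spikes_def power_divide)
  have xj: "(x $ j)\<^sup>2 = (if x $ j \<noteq> 0 then 1 / real (k + 1) else 0)" if "j \<in> {1..d}" for j
  proof -
    have "x $ j \<in> {1 / sqrt (real (k + 1)), - 1 / sqrt (real (k + 1)), 0}"
      using assms that unfolding spikes_def by blast
    then show ?thesis by (auto simp: power_divide)
  qed
  have "{..<d + 1} = insert 0 {1..d}" by auto
  then have "(\<Sum>j<d + 1. (x $ j)\<^sup>2) = (x $ 0)\<^sup>2 + (\<Sum>j\<in>{1..d}. (x $ j)\<^sup>2)" by simp
  also have "(\<Sum>j\<in>{1..d}. (x $ j)\<^sup>2) = (\<Sum>j\<in>{1..d}. if x $ j \<noteq> 0 then 1 / real (k + 1) else 0)"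
    by (intro sum.cong refl xj)
  also have "\<dots> = card {i \<in> {1..d}. x $ i \<noteq> 0} / real (k + 1)"
    by (simp add: sum.If_cases Int_def)
  also have "card {i \<in> {1..d}. x $ i \<noteq> 0} = k" using assms unfolding spikes_def by blast
  finally show "(\<Sum>j<d + 1. (x $ j)\<^sup>2) = 1" by (simp add: x0 field_simps)
qed

context
  fixes d k n :: nat and \<theta> :: real
  assumes theta: "0 \<le> \<theta>" "\<theta> < 1" and kd: "k \<le> d"
begin

lemma
  assumes x: "x \<in> spikes d k"
  shows integrable_spiked_sample_hermite:
      "integrable (Pi\<^sub>M {..<n} (\<lambda>_. mv_normal (d + 1) (spiked_cov d \<theta> x))) (sample_hermite n d \<beta>)"
    and integral_spiked_sample_hermite:
      "integral\<^sup>L (Pi\<^sub>M {..<n} (\<lambda>_. mv_normal (d + 1) (spiked_cov d \<theta> x))) (sample_hermite n d \<beta>) =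
        (\<Prod>i<n. spiked_coeff \<theta> (\<Sum>j<d + 1. \<beta> i j) * (\<Prod>j<d + 1. (x $ j) ^ \<beta> i j))"
proof -
  note ux = theta spikes_unit_norm[OF x]
  interpret product_sigma_finite "\<lambda>_::nat. mv_normal (d + 1) (spiked_cov d \<theta> x)"
    unfolding product_sigma_finite_def
    using prob_space_spiked[OF ux] by (simp add: prob_space_imp_sigma_finite)
  show "integrable (Pi\<^sub>M {..<n} (\<lambda>_. mv_normal (d + 1) (spiked_cov d \<theta> x))) (sample_hermite n d \<beta>)"
    unfolding sample_hermite_def
    by (rule product_integrable_prod) (use integrable_spiked_hermite[OF ux] in auto)
  show "integral\<^sup>L (Pi\<^sub>M {..<n} (\<lambda>_. mv_normal (d + 1) (spiked_cov d \<theta> x))) (sample_hermite n d \<beta>) =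
        (\<Prod>i<n. spiked_coeff \<theta> (\<Sum>j<d + 1. \<beta> i j) * (\<Prod>j<d + 1. (x $ j) ^ \<beta> i j))"
    unfolding sample_hermite_def
    using product_integral_prod[of "{..<n}" "\<lambda>i z. \<Prod>j<d + 1. poly (hermite (\<beta> i j)) (z j)"]
      integrable_spiked_hermite[OF ux] spiked_hermite_expectation[OF ux]
    by (simp del: prod.lessThan_Suc sum.lessThan_Suc)
qed

lemma integral_planted_hermite_sum:
  assumes "finite G"
  shows "(LINT z|planted_law d k \<theta> n. (\<Sum>\<beta>\<in>G. F \<beta> * sample_hermite n d \<beta> z)) =
    (\<Sum>\<beta>\<in>G. F \<beta> * planted_coeff d k \<theta> n \<beta>)"
proof -
  define K where "K x = Pi\<^sub>M {..<n} (\<lambda>_. mv_normal (d + 1) (spiked_cov d \<theta> x))" for x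
  have fin: "finite (spikes d k)" using card_spikes_pos[OF kd] by (rule card_ge_0_finite)
  have ne: "spikes d k \<noteq> {}" using card_spikes_pos[OF kd] by auto
  have "(LINT z|planted_law d k \<theta> n. (\<Sum>\<beta>\<in>G. F \<beta> * sample_hermite n d \<beta> z)) =
    (\<Sum>x\<in>spikes d k. LINT z|K x. (\<Sum>\<beta>\<in>G. F \<beta> * sample_hermite n d \<beta> z)) / card (spikes d k)"
    unfolding planted_law_def K_def[abs_def, symmetric]
  proof (rule integral_bind_uniform_count_measure[OF fin ne])
    fix x assume x: "x \<in> spikes d k"
    show "prob_space (K x)"
      unfolding K_def by (intro prob_space_PiM prob_space_spiked[OF theta spikes_unit_norm[OF x]])
    show "sets (K x) = sets (Pi\<^sub>M {..<n} (\<lambda>_. Pi\<^sub>M {..<d + 1} (\<lambda>_. borel)))"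
      unfolding K_def by (intro sets_PiM_cong refl) (simp add: mv_normal_def cong: sets_PiM_cong)
    show "integrable (K x) (\<lambda>z. \<Sum>\<beta>\<in>G. F \<beta> * sample_hermite n d \<beta> z)"
      unfolding K_def
      by (intro Bochner_Integration.integrable_sum integrable_mult_right integrable_spiked_sample_hermite x)
  qed
  also have "\<dots> = (\<Sum>x\<in>spikes d k. \<Sum>\<beta>\<in>G. F \<beta> * (\<Prod>i<n. spiked_coeff \<theta> (\<Sum>j<d + 1. \<beta> i j) *
      (\<Prod>j<d + 1. (x $ j) ^ \<beta> i j))) / card (spikes d k)"
  proof (intro arg_cong2[where f = "(/)"] sum.cong refl)
    fix x assume x: "x \<in> spikes d k"
    have "(LINT z|K x. (\<Sum>\<beta>\<in>G. F \<beta> * sample_hermite n d \<beta> z)) = (\<Sum>\<beta>\<in>G. F \<beta> * integral\<^sup>L (K x) (sample_hermite n d \<beta>))"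
      unfolding K_def using integrable_spiked_sample_hermite[OF x]
      by (subst Bochner_Integration.integral_sum) auto
    then show "(LINT z|K x. (\<Sum>\<beta>\<in>G. F \<beta> * sample_hermite n d \<beta> z)) = (\<Sum>\<beta>\<in>G. F \<beta> * (\<Prod>i<n. spiked_coeff \<theta> (\<Sum>j<d + 1. \<beta> i j) *
      (\<Prod>j<d + 1. (x $ j) ^ \<beta> i j)))"
      unfolding K_def by (simp only: integral_spiked_sample_hermite[OF x])
  qed
  also have "\<dots> = (\<Sum>\<beta>\<in>G. F \<beta> * planted_coeff d k \<theta> n \<beta>)"
    unfolding planted_coeff_def
    by (subst sum.swap) (simp only: sum_distrib_left sum_divide_distrib times_divide_eq_right)
  finally show ?thesis .
qed

end

section \<open>Orthogonality under the null law and Hermite expansion of polynomials\<close>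

lemma
  fixes n d :: nat
  shows integrable_null_sample_hermite:
      "integrable (null_law d n) (\<lambda>z. sample_hermite n d \<beta> z * sample_hermite n d \<beta>' z)"
    and integral_null_sample_hermite:
      "(LINT z|null_law d n. sample_hermite n d \<beta> z * sample_hermite n d \<beta>' z) =
         (\<Prod>i<n. \<Prod>j<d + 1. if \<beta> i j = \<beta>' i j then fact (\<beta> i j) else 0)"
proof -
  define R where "R = Pi\<^sub>M {..<d + 1} (\<lambda>_. std_normal_distribution)"
  interpret N: product_sigma_finite "\<lambda>_::nat. std_normal_distribution"
    by (rule product_sigma_finite_std_normal)
  interpret R: product_sigma_finite "\<lambda>_::nat. R"
    unfolding product_sigma_finite_def R_def
    by (simp add: prob_space_PiM_std_normal prob_space_imp_sigma_finite)
  define g where "g i y = (\<Prod>j<d + 1. poly (hermite (\<beta> i j)) (y j) * poly (hermite (\<beta>' i j)) (y j))" for i and y :: "nat \<Rightarrow> real"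
  have i1: "integrable std_normal_distribution (\<lambda>y. poly (hermite a) y * poly (hermite b) y)" for a b
    using integrable_poly_std_normal[of "hermite a * hermite b"] by (simp add: poly_mult[abs_def])
  have i2: "integrable R (g i)" for i
    unfolding R_def g_def by (rule N.product_integrable_prod) (auto intro: i1)
  have int2: "integral\<^sup>L R (g i) = (\<Prod>j<d + 1. if \<beta> i j = \<beta>' i j then fact (\<beta> i j) else 0)" for i
  proof -
    have "integral\<^sup>L R (g i) = (\<Prod>j<d + 1. LINT y|std_normal_distribution.
        poly (hermite (\<beta> i j)) y * poly (hermite (\<beta>' i j)) y)"
      unfolding R_def g_def by (rule N.product_integral_prod) (auto intro: i1)
    then show ?thesis by (simp only: hermite_orthogonal)
  qed
  have eq: "(\<lambda>z. sample_hermite n d \<beta> z * sample_hermite n d \<beta>' z) = (\<lambda>z. \<Prod>i<n. g i (z i))"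
    by (simp only: sample_hermite_def g_def prod.distrib)
  have law: "null_law d n = Pi\<^sub>M {..<n} (\<lambda>_. R)"
    by (simp only: null_law_def mv_normal_one R_def)
  show "integrable (null_law d n) (\<lambda>z. sample_hermite n d \<beta> z * sample_hermite n d \<beta>' z)"
    unfolding eq law by (rule R.product_integrable_prod) (auto intro: i2)
  have "(LINT z|Pi\<^sub>M {..<n} (\<lambda>_. R). (\<Prod>i<n. g i (z i))) = (\<Prod>i<n. integral\<^sup>L R (g i))"
    by (rule R.product_integral_prod) (auto intro: i2)
  then show "(LINT z|null_law d n. sample_hermite n d \<beta> z * sample_hermite n d \<beta>' z) =
         (\<Prod>i<n. \<Prod>j<d + 1. if \<beta> i j = \<beta>' i j then fact (\<beta> i j) else 0)"
    unfolding eq law int2 .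
qed

definition low_degree_indices :: "nat \<Rightarrow> nat \<Rightarrow> nat \<Rightarrow> (nat \<Rightarrow> nat \<Rightarrow> nat) set" where
  "low_degree_indices n d D = (\<Union>M\<le>D. nested_compositions {..<n} {..<d + 1} M)"

lemma finite_low_degree_indices: "finite (low_degree_indices n d D)"
  by (auto simp: low_degree_indices_def finite_nested_compositions)

lemma low_degree_indices_extensional:
  "low_degree_indices n d D \<subseteq> {..<n} \<rightarrow>\<^sub>E ({..<d + 1} \<rightarrow>\<^sub>E UNIV)"
  by (auto simp: low_degree_indices_def nested_compositions_def)

text \<open>Expanding every coordinate power separately only uses indices in the box
  \<open>E\<close> below the exponents of \<open>m\<close>, so the total degree does not grow.
  Extending the coefficients by 0 outside \<open>E\<close> gives all monomials the same index
  set.\<close>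

lemma monomial_sample_hermite_expansion:
  fixes m :: "(nat \<times> nat) \<Rightarrow>\<^sub>0 nat"
  assumes keys: "Poly_Mapping.keys m \<subseteq> {..<n} \<times> {..<d + 1}"
    and deg: "(\<Sum>v\<in>Poly_Mapping.keys m. Poly_Mapping.lookup m v) \<le> D"
  obtains F where "\<And>z. (\<Prod>v\<in>Poly_Mapping.keys m. (case v of (i, j) \<Rightarrow> z i j) ^ Poly_Mapping.lookup m v) =
     (\<Sum>\<beta>\<in>low_degree_indices n d D. F \<beta> * sample_hermite n d \<beta> z)"
proof -
  define e where "e i j = Poly_Mapping.lookup m (i, j)" for i j
  obtain c :: "nat \<Rightarrow> nat \<Rightarrow> real" where c: "\<And>l x. x ^ l = (\<Sum>b\<le>l. c l b * poly (hermite b) x)"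
    by (rule monomial_hermite_expansion) blast
  define E where "E = PiE {..<n} (\<lambda>i. PiE {..<d + 1} (\<lambda>j. {..e i j}))"
  define F where "F \<beta> = (if \<beta> \<in> E then \<Prod>i<n. \<Prod>j<d + 1. c (e i j) (\<beta> i j) else 0)" for \<beta>
  have "(\<Sum>v\<in>Poly_Mapping.keys m. Poly_Mapping.lookup m v) = (\<Sum>v\<in>{..<n} \<times> {..<d + 1}. Poly_Mapping.lookup m v)"
    by (rule sum.mono_neutral_left) (use keys in \<open>auto simp: in_keys_iff\<close>)
  also have "\<dots> = (\<Sum>i<n. \<Sum>j<d + 1. e i j)"
    unfolding e_def by (simp only: sum.cartesian_product) (simp add: case_prod_beta)
  finally have deg': "(\<Sum>i<n. \<Sum>j<d + 1. e i j) \<le> D" using deg by simp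
  have E_sub: "E \<subseteq> low_degree_indices n d D"
  proof
    fix \<beta> assume b: "\<beta> \<in> E"
    have "(\<Sum>i<n. \<Sum>j<d + 1. \<beta> i j) \<le> (\<Sum>i<n. \<Sum>j<d + 1. e i j)"
      using b by (intro sum_mono) (fastforce simp: E_def PiE_iff)
    with deg' show "\<beta> \<in> low_degree_indices n d D"
      using b by (auto simp: low_degree_indices_def nested_compositions_def E_def PiE_iff)
  qed
  show thesis
  proof (rule that)
    fix z :: "nat \<Rightarrow> nat \<Rightarrow> real"
    have "(\<Prod>v\<in>Poly_Mapping.keys m. (case v of (i, j) \<Rightarrow> z i j) ^ Poly_Mapping.lookup m v) =
       (\<Prod>v\<in>{..<n} \<times> {..<d + 1}. (case v of (i, j) \<Rightarrow> z i j) ^ Poly_Mapping.lookup m v)"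
      by (rule prod.mono_neutral_left) (use keys in \<open>auto simp: in_keys_iff\<close>)
    also have "\<dots> = (\<Prod>i<n. \<Prod>j<d + 1. z i j ^ e i j)"
      unfolding e_def by (simp only: prod.cartesian_product) (simp add: case_prod_beta)
    also have "\<dots> = (\<Prod>i<n. \<Prod>j<d + 1. \<Sum>b\<le>e i j. c (e i j) b * poly (hermite b) (z i j))"
      by (simp only: c[symmetric])
    also have "\<dots> = (\<Prod>i<n. \<Sum>a\<in>PiE {..<d + 1} (\<lambda>j. {..e i j}). \<Prod>j<d + 1. c (e i j) (a j) * poly (hermite (a j)) (z i j))"
      by (intro prod.cong refl prod_sum_PiE) auto
    also have "\<dots> = (\<Sum>\<beta>\<in>E. \<Prod>i<n. \<Prod>j<d + 1. c (e i j) (\<beta> i j) * poly (hermite (\<beta> i j)) (z i j))"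
      unfolding E_def by (rule prod_sum_PiE) (auto intro: finite_PiE)
    also have "\<dots> = (\<Sum>\<beta>\<in>E. F \<beta> * sample_hermite n d \<beta> z)"
      by (intro sum.cong refl) (simp only: F_def if_True sample_hermite_def prod.distrib)
    also have "\<dots> = (\<Sum>\<beta>\<in>low_degree_indices n d D. F \<beta> * sample_hermite n d \<beta> z)"
      by (rule sum.mono_neutral_left[OF finite_low_degree_indices E_sub]) (auto simp: F_def)
    finally show "(\<Prod>v\<in>Poly_Mapping.keys m. (case v of (i, j) \<Rightarrow> z i j) ^ Poly_Mapping.lookup m v) =
       (\<Sum>\<beta>\<in>low_degree_indices n d D. F \<beta> * sample_hermite n d \<beta> z)" .
  qed
qed

lemma rpoly_sample_hermite_expansion:
  fixes f :: "(nat \<times> nat) rpoly"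
  assumes "rpoly_vars f \<subseteq> {..<n} \<times> {..d}"
  obtains F where "sample_eval f = (\<lambda>z. \<Sum>\<beta>\<in>low_degree_indices n d (rpoly_degree f). F \<beta> * sample_hermite n d \<beta> z)"
proof -
  let ?G = "low_degree_indices n d (rpoly_degree f)"
  have "\<forall>m\<in>Poly_Mapping.keys f. \<exists>F. \<forall>z. (\<Prod>v\<in>Poly_Mapping.keys m. (case v of (i, j) \<Rightarrow> z i j) ^ Poly_Mapping.lookup m v) =
     (\<Sum>\<beta>\<in>?G. F \<beta> * sample_hermite n d \<beta> z)"
  proof
    fix m assume m: "m \<in> Poly_Mapping.keys f"
    have "Poly_Mapping.keys m \<subseteq> {..<n} \<times> {..<d + 1}"
      using assms m by (auto simp: rpoly_vars_def less_Suc_eq_le)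
    moreover have "(\<Sum>v\<in>Poly_Mapping.keys m. Poly_Mapping.lookup m v) \<le> rpoly_degree f"
      unfolding rpoly_degree_def using m by (intro Max_ge) auto
    ultimately show "\<exists>F. \<forall>z. (\<Prod>v\<in>Poly_Mapping.keys m. (case v of (i, j) \<Rightarrow> z i j) ^ Poly_Mapping.lookup m v) =
      (\<Sum>\<beta>\<in>?G. F \<beta> * sample_hermite n d \<beta> z)"
      by (rule monomial_sample_hermite_expansion) blast
  qed
  from bchoice[OF this] obtain F where F: "\<forall>m\<in>Poly_Mapping.keys f. \<forall>z.
      (\<Prod>v\<in>Poly_Mapping.keys m. (case v of (i, j) \<Rightarrow> z i j) ^ Poly_Mapping.lookup m v) =
      (\<Sum>\<beta>\<in>?G. F m \<beta> * sample_hermite n d \<beta> z)" by blast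
  have "sample_eval f z = (\<Sum>\<beta>\<in>?G. (\<Sum>m\<in>Poly_Mapping.keys f. Poly_Mapping.lookup f m * F m \<beta>) * sample_hermite n d \<beta> z)" for z
  proof -
    have "sample_eval f z = (\<Sum>m\<in>Poly_Mapping.keys f. Poly_Mapping.lookup f m * (\<Sum>\<beta>\<in>?G. F m \<beta> * sample_hermite n d \<beta> z))"
      unfolding rpoly_eval_def by (intro sum.cong refl) (simp add: F)
    also have "\<dots> = (\<Sum>m\<in>Poly_Mapping.keys f. \<Sum>\<beta>\<in>?G. Poly_Mapping.lookup f m * F m \<beta> * sample_hermite n d \<beta> z)"
      by (simp only: sum_distrib_left mult.assoc)
    also have "\<dots> = (\<Sum>\<beta>\<in>?G. \<Sum>m\<in>Poly_Mapping.keys f. Poly_Mapping.lookup f m * F m \<beta> * sample_hermite n d \<beta> z)"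
      by (rule sum.swap)
    finally show ?thesis by (simp only: sum_distrib_right)
  qed
  then show thesis by (intro that) auto
qed

text \<open>The squared null norm of a Hermite product.\<close>

definition index_fact :: "nat \<Rightarrow> nat \<Rightarrow> (nat \<Rightarrow> nat \<Rightarrow> nat) \<Rightarrow> real" where
  "index_fact n d \<beta> = (\<Prod>i<n. \<Prod>j<d + 1. fact (\<beta> i j))"

lemma index_fact_pos: "index_fact n d \<beta> > 0"
  unfolding index_fact_def by (intro prod_pos) auto

text \<open>Extensionality of the indices matters here: distinct ones must differ at a coordinate
  that occurs in the product.\<close>

lemma null_hermite_orthogonal:
  assumes "\<beta> \<in> {..<n} \<rightarrow>\<^sub>E ({..<d + 1} \<rightarrow>\<^sub>E UNIV)" "\<beta>' \<in> {..<n} \<rightarrow>\<^sub>E ({..<d + 1} \<rightarrow>\<^sub>E UNIV)"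
  shows "(LINT z|null_law d n. sample_hermite n d \<beta> z * sample_hermite n d \<beta>' z) =
     (if \<beta> = \<beta>' then index_fact n d \<beta> else 0)"
proof (cases "\<beta> = \<beta>'")
  case True
  then show ?thesis unfolding integral_null_sample_hermite index_fact_def by simp
next
  case False
  have "\<exists>i<n. \<exists>j<d + 1. \<beta> i j \<noteq> \<beta>' i j"
  proof (rule ccontr)
    assume *: "\<not> ?thesis"
    have "\<beta> = \<beta>'"
    proof (rule PiE_ext[OF assms])
      fix i assume i: "i \<in> {..<n}"
      show "\<beta> i = \<beta>' i"
        by (rule PiE_ext[where k = "{..<d + 1}" and s = "\<lambda>_. UNIV"]) (use assms i * in auto)
    qed
    with False show False by blast
  qed
  then obtain i j where ij: "i < n" "j < d + 1" "\<beta> i j \<noteq> \<beta>' i j" by blast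
  have "(\<Prod>j<d + 1. if \<beta> i j = \<beta>' i j then fact (\<beta> i j) else 0 :: real) = 0"
    using ij by (intro prod_zero bexI[of _ j]) auto
  then have "(\<Prod>i<n. \<Prod>j<d + 1. if \<beta> i j = \<beta>' i j then fact (\<beta> i j) else 0 :: real) = 0"
    by (rule prod_zero[OF finite_lessThan bexI]) (use ij in simp)
  then show ?thesis unfolding integral_null_sample_hermite using False by simp
qed

lemma integral_null_hermite_sum_sq:
  assumes "finite G" "G \<subseteq> {..<n} \<rightarrow>\<^sub>E ({..<d + 1} \<rightarrow>\<^sub>E UNIV)"
  shows "(LINT z|null_law d n. (\<Sum>\<beta>\<in>G. F \<beta> * sample_hermite n d \<beta> z)\<^sup>2) =
    (\<Sum>\<beta>\<in>G. (F \<beta>)\<^sup>2 * index_fact n d \<beta>)"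
proof -
  have "(\<lambda>z. (\<Sum>\<beta>\<in>G. F \<beta> * sample_hermite n d \<beta> z)\<^sup>2) =
     (\<lambda>z. \<Sum>\<beta>\<in>G. \<Sum>\<beta>'\<in>G. F \<beta> * F \<beta>' * (sample_hermite n d \<beta> z * sample_hermite n d \<beta>' z))"
    by (simp add: power2_eq_square sum_product mult_ac)
  then have "(LINT z|null_law d n. (\<Sum>\<beta>\<in>G. F \<beta> * sample_hermite n d \<beta> z)\<^sup>2) =
     (\<Sum>\<beta>\<in>G. \<Sum>\<beta>'\<in>G. F \<beta> * F \<beta>' * (LINT z|null_law d n. sample_hermite n d \<beta> z * sample_hermite n d \<beta>' z))"
    using integrable_null_sample_hermite[of d n]
    by (simp add: Bochner_Integration.integral_sum Bochner_Integration.integrable_sum)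
  also have "\<dots> = (\<Sum>\<beta>\<in>G. \<Sum>\<beta>'\<in>G. if \<beta> = \<beta>' then (F \<beta>)\<^sup>2 * index_fact n d \<beta> else 0)"
    using assms(2) by (intro sum.cong refl) (auto simp: null_hermite_orthogonal subset_iff power2_eq_square)
  also have "\<dots> = (\<Sum>\<beta>\<in>G. (F \<beta>)\<^sup>2 * index_fact n d \<beta>)" using assms(1) by simp
  finally show ?thesis .
qed

text \<open>The index of the constant 1; its coefficient in an expansion is the null mean.\<close>

definition zero_index :: "nat \<Rightarrow> nat \<Rightarrow> nat \<Rightarrow> nat \<Rightarrow> nat" where
  "zero_index n d = (\<lambda>i\<in>{..<n}. \<lambda>j\<in>{..<d + 1}. 0)"

lemma sample_hermite_zero_index: "sample_hermite n d (zero_index n d) z = 1"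
  unfolding sample_hermite_def zero_index_def by (intro prod.neutral ballI) simp

lemma nested_compositions_zero:
  "nested_compositions {..<n} {..<d + 1} 0 = {zero_index n d}"
proof (intro equalityI subsetI)
  fix \<beta> assume b: "\<beta> \<in> nested_compositions {..<n} {..<d + 1} 0"
  have z: "zero_index n d \<in> {..<n} \<rightarrow>\<^sub>E ({..<d + 1} \<rightarrow>\<^sub>E UNIV)" by (auto simp: zero_index_def)
  have "\<beta> = zero_index n d"
  proof (rule PiE_ext[OF _ z])
    show b': "\<beta> \<in> {..<n} \<rightarrow>\<^sub>E ({..<d + 1} \<rightarrow>\<^sub>E UNIV)" using b by (simp add: nested_compositions_def)
    fix i assume i: "i \<in> {..<n}"
    show "\<beta> i = zero_index n d i"
    proof (rule PiE_ext[where k = "{..<d + 1}" and s = "\<lambda>_. UNIV"])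
      fix j assume "j \<in> {..<d + 1}"
      then show "\<beta> i j = zero_index n d i j"
        using b i by (simp add: nested_compositions_def zero_index_def del: sum.lessThan_Suc)
    qed (use b' z i in auto)
  qed
  then show "\<beta> \<in> {zero_index n d}" by simp
qed (auto simp: zero_index_def nested_compositions_def)

lemma integral_null_hermite_sum:
  assumes "zero_index n d \<in> G" "finite G" "G \<subseteq> {..<n} \<rightarrow>\<^sub>E ({..<d + 1} \<rightarrow>\<^sub>E UNIV)"
  shows "(LINT z|null_law d n. (\<Sum>\<beta>\<in>G. F \<beta> * sample_hermite n d \<beta> z)) = F (zero_index n d)"
proof -
  let ?o = "zero_index n d"
  have i: "integrable (null_law d n) (sample_hermite n d \<beta>)" for \<beta>
    using integrable_null_sample_hermite[of d n \<beta> ?o] by (simp add: sample_hermite_zero_index)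
  have "integral\<^sup>L (null_law d n) (sample_hermite n d \<beta>) = (if \<beta> = ?o then 1 else 0)" if "\<beta> \<in> G" for \<beta>
  proof -
    have "integral\<^sup>L (null_law d n) (sample_hermite n d \<beta>) = (if \<beta> = ?o then index_fact n d \<beta> else 0)"
      using null_hermite_orthogonal[OF subsetD[OF assms(3) that] subsetD[OF assms(3,1)]]
      by (simp add: sample_hermite_zero_index)
    moreover have "index_fact n d ?o = 1"
      unfolding index_fact_def zero_index_def by (intro prod.neutral ballI) simp
    ultimately show ?thesis by simp
  qed
  then have "(\<Sum>\<beta>\<in>G. F \<beta> * integral\<^sup>L (null_law d n) (sample_hermite n d \<beta>)) =
      (\<Sum>\<beta>\<in>G. if \<beta> = ?o then F \<beta> else 0)"
    by (intro sum.cong) auto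
  then show ?thesis using assms i by (simp add: Bochner_Integration.integral_sum)
qed

section \<open>The advantage bound for fixed n, and its asymptotic form\<close>

text \<open>Mean zero removes the constant term, so only levels 1 to deg f remain, and their
  geometric bounds sum to at most 1. The smallness hypothesis at the full degree implies it at every
  lower level.\<close>

lemma low_degree_advantage_le:
  fixes f :: "(nat \<times> nat) rpoly"
  assumes "n \<ge> 1" "1 \<le> k" "k \<le> d" "0 \<le> \<theta>" "\<theta> < 1"
    and vars: "rpoly_vars f \<subseteq> {..<n} \<times> {..d}"
    and small: "(real n + real (rpoly_degree f)) * (real k ^ 2 / d + real (rpoly_degree f)) \<le> real k ^ 2 / 2916"
    and mean: "integral\<^sup>L (null_law d n) (sample_eval f) = 0"
  shows "integral\<^sup>L (planted_law d k \<theta> n) (sample_eval f)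
         / sqrt (integral\<^sup>L (null_law d n) (\<lambda>z. (sample_eval f z)\<^sup>2)) \<le> 1"
proof -
  define D where "D = rpoly_degree f"
  define G where "G = low_degree_indices n d D"
  define o' where "o' = zero_index n d"
  obtain F where F: "sample_eval f = (\<lambda>z. \<Sum>\<beta>\<in>G. F \<beta> * sample_hermite n d \<beta> z)"
    unfolding G_def D_def by (rule rpoly_sample_hermite_expansion[OF vars])
  have fin: "finite G" by (simp add: G_def finite_low_degree_indices)
  have ext: "G \<subseteq> {..<n} \<rightarrow>\<^sub>E ({..<d + 1} \<rightarrow>\<^sub>E UNIV)" by (simp only: G_def low_degree_indices_extensional)
  have G_eq: "G = insert o' (\<Union>M\<in>{1..D}. nested_compositions {..<n} {..<d + 1} M)"
  proof -
    have "{..D} = insert 0 {1..D}" by auto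
    then show ?thesis
      by (simp only: G_def low_degree_indices_def UN_insert nested_compositions_zero o'_def) simp
  qed
  then have oG: "o' \<in> G" by simp
  have oF: "F o' = 0"
    using mean integral_null_hermite_sum[OF oG[unfolded o'_def] fin ext, of F]
    by (simp add: F o'_def)
  let ?P = "\<lambda>\<beta>. planted_coeff d k \<theta> n \<beta>"
  let ?c = "index_fact n d"
  have "(\<Sum>\<beta>\<in>G - {o'}. (?P \<beta>)\<^sup>2 / ?c \<beta>) \<le>
      (\<Sum>\<beta>\<in>(\<Union>M\<in>{1..D}. nested_compositions {..<n} {..<d + 1} M). (?P \<beta>)\<^sup>2 / ?c \<beta>)"
    by (rule sum_mono2) (auto simp: G_eq finite_nested_compositions less_imp_le[OF index_fact_pos])
  also have "\<dots> = (\<Sum>M\<in>{1..D}. \<Sum>\<beta>\<in>nested_compositions {..<n} {..<d + 1} M. (?P \<beta>)\<^sup>2 / ?c \<beta>)"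
    by (rule sum.UNION_disjoint)
       (simp_all add: finite_nested_compositions del: lessThan_Suc, auto simp: nested_compositions_def)
  also have "\<dots> \<le> (\<Sum>M\<in>{1..D}. (1 / 2) ^ M)"
  proof (rule sum_mono)
    fix M assume M: "M \<in> {1..D}"
    have "(real n + real M) * (real k ^ 2 / d + real M) \<le> (real n + real D) * (real k ^ 2 / d + real D)"
      using M by (intro mult_mono) auto
    also have "\<dots> \<le> real k ^ 2 / 2916" using small by (simp add: D_def)
    finally have "row_weight \<theta> n M * overlap_moment d k M \<le> (1 / 2) ^ M"
      using assms M by (intro planted_coeff_level_le) auto
    then show "(\<Sum>\<beta>\<in>nested_compositions {..<n} {..<d + 1} M. (?P \<beta>)\<^sup>2 / ?c \<beta>) \<le> (1 / 2) ^ M"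
      unfolding index_fact_def sum_planted_coeff_sq .
  qed
  also have "\<dots> \<le> 1"
  proof -
    have "(\<Sum>M\<in>{1..D}. (1 / 2 :: real) ^ M) = 1 - (1 / 2) ^ D" by (induction D) (auto simp: field_simps)
    then show ?thesis by simp
  qed
  finally have bound: "(\<Sum>\<beta>\<in>G - {o'}. (?P \<beta>)\<^sup>2 / ?c \<beta>) \<le> 1" .
  have "integral\<^sup>L (planted_law d k \<theta> n) (sample_eval f) = (\<Sum>\<beta>\<in>G. F \<beta> * ?P \<beta>)"
    unfolding F by (rule integral_planted_hermite_sum) (use assms fin in auto)
  also have "\<dots> = (\<Sum>\<beta>\<in>G - {o'}. F \<beta> * ?P \<beta>)"
    using fin oG oF by (subst sum.remove[of _ o']) auto
  \<comment> \<open>Weighting by the norms makes the first Cauchy--Schwarz factor the null second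
    moment of f and the second one the sum bounded above.\<close>
  also have "\<dots> = (\<Sum>\<beta>\<in>G - {o'}. (F \<beta> * sqrt (?c \<beta>)) * (?P \<beta> / sqrt (?c \<beta>)))"
    by (intro sum.cong refl) (use index_fact_pos[of n d] in \<open>simp add: less_imp_neq[symmetric]\<close>)
  also have "\<dots> \<le> sqrt ((\<Sum>\<beta>\<in>G - {o'}. (F \<beta> * sqrt (?c \<beta>))\<^sup>2) * (\<Sum>\<beta>\<in>G - {o'}. (?P \<beta> / sqrt (?c \<beta>))\<^sup>2))"
    by (rule real_le_rsqrt) (rule Cauchy_Schwarz_ineq_sum)
  also have "(\<Sum>\<beta>\<in>G - {o'}. (F \<beta> * sqrt (?c \<beta>))\<^sup>2) = (\<Sum>\<beta>\<in>G - {o'}. (F \<beta>)\<^sup>2 * ?c \<beta>)"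
    using index_fact_pos[of n d] by (intro sum.cong refl) (simp add: power_mult_distrib less_imp_le)
  also have "\<dots> = (\<Sum>\<beta>\<in>G. (F \<beta>)\<^sup>2 * ?c \<beta>)"
    using fin oG oF by (subst (2) sum.remove[of _ o']) auto
  also have "(\<Sum>\<beta>\<in>G - {o'}. (?P \<beta> / sqrt (?c \<beta>))\<^sup>2) = (\<Sum>\<beta>\<in>G - {o'}. (?P \<beta>)\<^sup>2 / ?c \<beta>)"
    using index_fact_pos[of n d] by (intro sum.cong refl) (simp add: power_divide less_imp_le)
  also have "(\<Sum>\<beta>\<in>G. (F \<beta>)\<^sup>2 * ?c \<beta>) = integral\<^sup>L (null_law d n) (\<lambda>z. (sample_eval f z)\<^sup>2)"
    unfolding fun_cong[OF F] by (rule integral_null_hermite_sum_sq[OF fin ext, symmetric])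
  finally have "integral\<^sup>L (planted_law d k \<theta> n) (sample_eval f) \<le>
    sqrt (integral\<^sup>L (null_law d n) (\<lambda>z. (sample_eval f z)\<^sup>2) * (\<Sum>\<beta>\<in>G - {o'}. (?P \<beta>)\<^sup>2 / ?c \<beta>))" .
  also have "\<dots> \<le> sqrt (integral\<^sup>L (null_law d n) (\<lambda>z. (sample_eval f z)\<^sup>2) * 1)"
    by (intro real_sqrt_le_mono mult_left_mono bound Bochner_Integration.integral_nonneg) auto
  finally have "integral\<^sup>L (planted_law d k \<theta> n) (sample_eval f) \<le>
    sqrt (integral\<^sup>L (null_law d n) (\<lambda>z. (sample_eval f z)\<^sup>2))" by simp
  \<comment> \<open>A quotient with denominator 0 has the value 0.\<close>
  moreover have "a / c \<le> 1" if "a \<le> c" "0 \<le> c" for a c :: real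
    using that by (cases "c = 0") (auto simp: divide_le_eq_1)
  ultimately show ?thesis by simp
qed

theorem theoremB4:
  fixes \<delta> :: real and d k :: "nat \<Rightarrow> nat" and \<theta> :: "nat \<Rightarrow> real"
  assumes "0 < \<delta>" and "\<delta> \<le> 1 / 10"
    and "\<And>n. k n \<le> d n"
    and "\<And>n. 0 < \<theta> n \<and> \<theta> n < 1"
    and "(\<lambda>n. real n) \<in> o(\<lambda>n. min (real (d n)) (real (k n) powr (2 - \<delta>)))"
  shows "\<exists>\<epsilon> :: nat \<Rightarrow> real. \<epsilon> \<in> o(\<lambda>_. 1) \<and>
    (\<forall>\<^sub>F n in sequentially. \<forall>f :: (nat \<times> nat) rpoly.
       rpoly_vars f \<subseteq> {..<n} \<times> {..d n} \<longrightarrow>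
       f \<noteq> 0 \<longrightarrow>
       real (rpoly_degree f) \<le> real (k n) powr \<delta> \<longrightarrow>
       integral\<^sup>L (null_law (d n) n) (sample_eval f) = 0 \<longrightarrow>
       integral\<^sup>L (planted_law (d n) (k n) (\<theta> n) n) (sample_eval f)
         / sqrt (integral\<^sup>L (null_law (d n) n) (\<lambda>z. (sample_eval f z)\<^sup>2)) \<le> 1 + \<epsilon> n)"
proof (intro exI conjI)
  \<comment> \<open>Four contributions of at most C k^2 must fit below k^2 / 2916, and 4 / 12000 = 1
    / 3000 does.\<close>
  define C where "C = (1 / 12000 :: real)"
  have C: "C > 0" by (simp add: C_def)
  \<comment> \<open>Beyond \<open>k0\<close> the degree bound k^\<delta> is at most C k.\<close>
  have lim: "(\<lambda>k. real k powr (\<delta> - 1)) \<longlonglongrightarrow> 0"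
    using assms(1,2) by real_asymp
  obtain k0 :: nat where k0: "\<And>k. k \<ge> k0 \<Longrightarrow> real k powr (\<delta> - 1) < C"
    using order_tendstoD(2)[OF lim C] by (auto simp: eventually_at_top_linorder)
  have ev: "\<forall>\<^sub>F n in sequentially. real n \<le> C * min (real (d n)) (real (k n) powr (2 - \<delta>))"
    using landau_o.smallD[OF assms(5) C] by (auto simp: powr_ge_zero elim!: eventually_mono)
  \<comment> \<open>The error term can be taken to be 0: the ratio is at most 1 for all large
    n.\<close>
  show "(\<lambda>_. 0 :: real) \<in> o(\<lambda>_. 1 :: real)" by simp
  \<comment> \<open>Together with n <= C k^(2 - \<delta>) this forces k above \<open>k0\<close>: the
    growth of k follows from that of n.\<close>
  have "\<forall>\<^sub>F n in sequentially. real n > real (max k0 1) powr (2 - \<delta>)" by real_asymp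
  then show "\<forall>\<^sub>F n in sequentially. \<forall>f :: (nat \<times> nat) rpoly.
       rpoly_vars f \<subseteq> {..<n} \<times> {..d n} \<longrightarrow>
       f \<noteq> 0 \<longrightarrow>
       real (rpoly_degree f) \<le> real (k n) powr \<delta> \<longrightarrow>
       integral\<^sup>L (null_law (d n) n) (sample_eval f) = 0 \<longrightarrow>
       integral\<^sup>L (planted_law (d n) (k n) (\<theta> n) n) (sample_eval f)
         / sqrt (integral\<^sup>L (null_law (d n) n) (\<lambda>z. (sample_eval f z)\<^sup>2)) \<le> 1 + 0"
    using ev eventually_ge_at_top[of 1]
  proof eventually_elim
    case (elim n)
    define K where "K = real (k n)"
    have n: "real n \<le> C * real (d n)" "real n \<le> C * K powr (2 - \<delta>)"
      using elim(2) C by (auto simp: K_def min_def split: if_splits intro: order_trans)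
    have "C * K powr (2 - \<delta>) \<le> K powr (2 - \<delta>)" by (simp add: C_def)
    then have "real (max k0 1) powr (2 - \<delta>) < K powr (2 - \<delta>)" using elim(1) n(2) by linarith
    then have "real (max k0 1) < K"
      using powr_mono2[of "2 - \<delta>" K "real (max k0 1)"] assms(2) by (force simp: K_def)
    then have k: "k n \<ge> 1" "k n \<ge> k0" by (auto simp: K_def)
    then have K: "K \<ge> 1" by (simp add: K_def)
    have d: "K \<le> real (d n)" using assms(3) by (simp add: K_def)
    have Kd: "K powr \<delta> \<le> C * K"
    proof -
      have "K powr \<delta> = K powr (\<delta> - 1) * K" using K by (simp add: powr_diff)
      also have "\<dots> \<le> C * K" using k0[OF k(2)] K by (intro mult_right_mono) (auto simp: K_def)
      finally show ?thesis .
    qed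
    show ?case
    proof (intro allI impI)
      fix f :: "(nat \<times> nat) rpoly"
      assume f: "rpoly_vars f \<subseteq> {..<n} \<times> {..d n}" "real (rpoly_degree f) \<le> real (k n) powr \<delta>"
        "integral\<^sup>L (null_law (d n) n) (sample_eval f) = 0"
      define D where "D = real (rpoly_degree f)"
      have D: "0 \<le> D" "D \<le> K powr \<delta>" using f by (auto simp: D_def K_def)
      \<comment> \<open>The exponents match here: the degree k^\<delta> uses up exactly the factor
        k^(-\<delta>) in the bound on n.\<close>
      have nD: "real n * D \<le> C * K\<^sup>2"
      proof -
        have "real n * D \<le> (C * K powr (2 - \<delta>)) * K powr \<delta>"
          using n D C by (intro mult_mono) auto
        also have "\<dots> = C * (K powr (2 - \<delta>) * K powr \<delta>)" by simp
        also have "K powr (2 - \<delta>) * K powr \<delta> = K\<^sup>2" using K by (simp flip: powr_add)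
        finally show ?thesis .
      qed
      have DK: "D \<le> C * K" using D Kd by linarith
      \<comment> \<open>The first term uses n <= C d and D <= C k <= C d, and the last one D <= C k
        with C <= 1.\<close>
      have "(real n + D) * (K\<^sup>2 / real (d n) + D) = (real n + D) / real (d n) * K\<^sup>2 + real n * D + D * D"
        using d K by (simp add: field_simps)
      also have "\<dots> \<le> (2 * C) * K\<^sup>2 + C * K\<^sup>2 + C * K\<^sup>2"
      proof (intro add_mono mult_right_mono nD)
        have "C * K \<le> C * real (d n)" using d C by simp
        then show "(real n + D) / real (d n) \<le> 2 * C" using n(1) DK d K by (simp add: divide_le_eq)
        have "D * D \<le> (C * K) * (C * K)" using DK D by (intro mult_mono) auto
        also have "\<dots> \<le> C * K\<^sup>2" using K by (simp add: C_def power2_eq_square)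
        finally show "D * D \<le> C * K\<^sup>2" .
      qed auto
      also have "\<dots> \<le> K\<^sup>2 / 2916" by (simp add: C_def)
      finally show "integral\<^sup>L (planted_law (d n) (k n) (\<theta> n) n) (sample_eval f)
         / sqrt (integral\<^sup>L (null_law (d n) n) (\<lambda>z. (sample_eval f z)\<^sup>2)) \<le> 1 + 0"
        using low_degree_advantage_le[of n "k n" "d n" "\<theta> n" f] elim(3) k(1) assms(3,4) f
        by (simp add: K_def D_def less_imp_le)
    qed
  qed
qed

end
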